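(* Let $0<d^-\leqslant d^+$ be fixed, let $d_j$ ($j\geqslant1$) satisfy $0<d^-\leqslant d_j\leqslant d^+$, let $\hat f(j)\in\mathbb C$ with $|\hat f(j)|\leqslant1$, and define $p_m$, $M_m$ by $$\sum_{m\geqslant0}p_mz^m=\exp\Big\{\sum_{j\geqslant1}\frac{d_j}{j}z^j\Big\},\qquad \sum_{m\geqslant0}M_mz^m=\exp\Big\{\sum_{j\geqslant1}d_j\frac{\hat f(j)}{j}z^j\Big\}.$$ For $N\geqslant1$ put $L_N(1)=\sum_{j=1}^N d_j\frac{\hat f(j)-1}{j}$ and $\rho=\rho(p)=\big(\sum_{j=1}^N\frac{|\hat f(j)-1|^p}{j}\big)^{1/p}$, with $\rho(\infty)=\max_{1\leqslant j\leqslant N}|\hat f(j)-1|$. Then for every fixed $p$ with $\infty\geqslant p>\max\{1,1/d^-\}$ there exists $\delta=\delta(d^-,d^+,p)>0$ such that if $\rho\leqslant\delta$ then $$\frac{M_N}{p_N}=\exp\{L_N(1)\}\left(1+\sum_{j=1}^N d_j\frac{\hat f(j)-1}{j}\Big(\frac{p_{N-j}}{p_N}-1\Big)+O(\rho^2)\right),$$ with the implied constant depending only on $d^-,d^+,p$.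
   Context: For a multiplicative function $f$ on $S_N$ with cycle values $\hat f(j)$ and the measure $\nu_{N,d}$ determined by cycle weights $d_j$, $M_N/p_N$ equals the $\nu_{N,d}$-mean of $f$. *)

theory Defs
  imports
    Complex_Main
    "HOL-Library.Extended_Real"
    "HOL-Computational_Algebra.Formal_Power_Series"
begin

text \<open>
  The formal power series \<open>exp (\<Sum>j\<ge>1. (c j / j) z^j)\<close>. The value \<open>c 0\<close> is not used; the inner
  series has constant term zero, so the composition is the usual one.
\<close>
definition exp_series :: "(nat \<Rightarrow> 'a::field_char_0) \<Rightarrow> 'a fps" where
  "exp_series c = fps_exp 1 oo Abs_fps (\<lambda>j. if j = 0 then 0 else c j / of_nat j)"

definition p_coeff :: "(nat \<Rightarrow> real) \<Rightarrow> nat \<Rightarrow> real" where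
  "p_coeff d m = fps_nth (exp_series d) m"

definition M_coeff :: "(nat \<Rightarrow> real) \<Rightarrow> (nat \<Rightarrow> complex) \<Rightarrow> nat \<Rightarrow> complex" where
  "M_coeff d f m = fps_nth (exp_series (\<lambda>j. complex_of_real (d j) * f j)) m"

definition L1 :: "(nat \<Rightarrow> real) \<Rightarrow> (nat \<Rightarrow> complex) \<Rightarrow> nat \<Rightarrow> complex" where
  "L1 d f N = (\<Sum>j=1..N. complex_of_real (d j) * ((f j - 1) / of_nat j))"

text \<open>
  The exponent \<open>p\<close> ranges over the extended reals so that \<open>p = \<infinity>\<close> is allowed; the definition is
  meant for \<open>p \<ge> 1\<close> and, when \<open>p = \<infinity>\<close>, for \<open>N \<ge> 1\<close>.
\<close>
definition rho :: "(nat \<Rightarrow> complex) \<Rightarrow> nat \<Rightarrow> ereal \<Rightarrow> real" where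
  "rho f N p =
    (if p = \<infinity> then Max ((\<lambda>j. cmod (f j - 1)) ` {1..N})
     else (\<Sum>j=1..N. cmod (f j - 1) powr real_of_ereal p / real j) powr (1 / real_of_ereal p))"

end

theory Submission
  imports Defs "HOL-Complex_Analysis.Complex_Analysis"
begin

text \<open>
  Let \<open>c j = d j * (f j - 1)\<close> for \<open>j \<le> N\<close> and \<open>c j = 0\<close> otherwise, let \<open>L\<close> be \<open>L1 d f N\<close> and put
  \<open>D(z) = (\<Sum>j. c j / j * z^j) - L\<close>, so that \<open>D(1) = 0\<close>. With \<open>P = \<Sum>m. p_m z^m\<close> one has
  \<open>M_N = exp L * [z^N] P exp D\<close>, and the terms \<open>1 + D\<close> of \<open>exp D\<close> produce the main term; the error is
  \<open>[z^N] P (exp D - 1 - D)\<close>.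

  The lower bound on the weights allows us to factor \<open>P = (1 - z)^(-\<theta>) B(z)\<close> with \<open>\<theta> = min d\<^sup>- 1\<close>, where
  \<open>B\<close> has nonnegative coefficients, so it is enough to bound the coefficients \<open>V n\<close> of
  \<open>(1 - z)^(-\<theta>) \<Phi>(D(z))\<close> for \<open>\<Phi> = exp\<close>, \<open>exp - 1\<close> and \<open>exp - 1 - id\<close> in turn. For a constant weight the
  recurrence is one-dimensional: if \<open>U\<close> belongs to \<open>\<Phi>'\<close>, then
  \<open>n V n = \<theta> (\<Sum>k<n. V k) + (\<Sum>j\<le>n. c j U (n - j))\<close>, so the partial sums of \<open>V\<close>, divided by those of
  \<open>(1 - z)^(-\<theta>)\<close>, have explicit increments. Since they converge to \<open>\<Phi>(D(1)) = \<Phi>(0)\<close>, they can be summed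
  from infinity, which costs one factor \<open>\<rho>\<close> at each step: by Hoelder's inequality the last sum is
  \<open>O(\<rho>)\<close> times the size of \<open>U\<close>, and this is where \<open>p > 1 / \<theta>\<close> is needed. For \<open>\<Phi> = exp\<close>,
  where \<open>U = V\<close>, the bound closes on itself once \<open>\<rho>\<close> is small. As \<open>\<Phi>(0)\<close> vanishes for the last
  two functions, the error is \<open>O(\<rho>\<^sup>2)\<close>.
\<close>

subsection \<open>Power sums and rising products\<close>

text \<open>Bernoulli's inequality, as weighted AM-GM for \<open>1 + x\<close> and \<open>1\<close>
  with weights \<open>a\<close> and \<open>1 - a\<close>. The bounds on power sums and on
  \<open>rise\<close> rest on it.\<close>

lemma powr_one_plus_le:
  fixes a x :: real
  assumes "0 \<le> a" "a \<le> 1" "x > -1"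
  shows "(1 + x) powr a \<le> 1 + a * x"
  using Youngs_inequality_0[of a "1 - a" "1 + x" 1] assms by (simp add: algebra_simps)

text \<open>Bernoulli at \<open>x = - 1 / k\<close>. The right side telescopes, which bounds the
  power sums in the next lemma.\<close>

lemma powr_diff_ge:
  fixes a k :: real
  assumes "0 \<le> a" "a \<le> 1" "1 \<le> k"
  shows "a * k powr (a - 1) \<le> k powr a - (k - 1) powr a"
proof (cases "k = 1")
  case False
  hence k: "k > 1" using assms by simp
  have "((k - 1) / k) powr a \<le> 1 - a / k"
    using powr_one_plus_le[of a "- 1 / k"] assms k by (simp add: field_simps)
  hence "(k - 1) powr a \<le> k powr a * (1 - a / k)"
    using k by (simp add: powr_divide field_simps)
  also have "\<dots> = k powr a - a * k powr (a - 1)"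
    using k by (simp add: powr_diff algebra_simps)
  finally show ?thesis by simp
qed (use assms in auto)

lemma sum_powr_le:
  fixes s :: real
  assumes "0 \<le> s" "s < 1"
  shows "(\<Sum>i=1..k. real i powr (- s)) \<le> real k powr (1 - s) / (1 - s)"
proof (induction k)
  case (Suc k)
  have "(1 - s) * real (Suc k) powr (- s) \<le> real (Suc k) powr (1 - s) - real k powr (1 - s)"
    using powr_diff_ge[of "1 - s" "real (Suc k)"] assms by simp
  hence "real (Suc k) powr (- s) \<le> (real (Suc k) powr (1 - s) - real k powr (1 - s)) / (1 - s)"
    using assms by (simp add: pos_le_divide_eq mult.commute)
  hence "real (Suc k) powr (- s) \<le> real (Suc k) powr (1 - s) / (1 - s) - real k powr (1 - s) / (1 - s)"
    by (simp add: diff_divide_distrib)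
  thus ?case using Suc by simp
qed simp

text \<open>The analogue for a convergent tail: Bernoulli at \<open>- 1 / (k + 1)\<close> again
  yields a telescoping majorant.\<close>

lemma powr_neg_le_diff:
  fixes e k :: real
  assumes "0 < e" "e \<le> 1" "1 \<le> k"
  shows "k powr (- 1 - e) \<le> 2 / e * (k powr (- e) - (k + 1) powr (- e))"
proof -
  have "(k / (k + 1)) powr e \<le> 1 - e / (k + 1)"
    using powr_one_plus_le[of e "- 1 / (k + 1)"] assms by (simp add: field_simps)
  hence "k powr (- e) * (k / (k + 1)) powr e \<le> k powr (- e) * (1 - e / (k + 1))"
    by (intro mult_left_mono) auto
  moreover have "k powr (- e) * (k / (k + 1)) powr e = (k + 1) powr (- e)"
    using assms by (simp add: powr_divide powr_minus field_simps)
  ultimately have "(k + 1) powr (- e) \<le> k powr (- e) * (1 - e / (k + 1))"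
    by simp
  hence "k powr (- e) * (e / (k + 1)) \<le> k powr (- e) - (k + 1) powr (- e)"
    by (simp add: algebra_simps)
  \<comment> \<open>The factor 2 comes from \<open>k + 1 \<le> 2 * k\<close>.\<close>
  moreover have "k powr (- e) * (e / (2 * k)) \<le> k powr (- e) * (e / (k + 1))"
    using assms by (intro mult_left_mono divide_left_mono) auto
  ultimately have "k powr (- e) * (e / (2 * k)) \<le> k powr (- e) - (k + 1) powr (- e)"
    by linarith
  moreover have "k powr (- e) * (e / (2 * k)) = e / 2 * k powr (- 1 - e)"
    using assms by (simp add: powr_diff powr_minus field_simps)
  ultimately have "e / 2 * k powr (- 1 - e) \<le> k powr (- e) - (k + 1) powr (- e)"
    by simp
  hence "2 / e * (e / 2 * k powr (- 1 - e)) \<le> 2 / e * (k powr (- e) - (k + 1) powr (- e))"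
    using assms by (intro mult_left_mono) auto
  thus ?thesis using assms by simp
qed

text \<open>Uniform in the upper end \<open>m\<close>, so that increments of order
  \<open>k powr (- 1 - e)\<close> can be summed from infinity back to \<open>n\<close>.\<close>

lemma sum_powr_tail_le:
  fixes e :: real
  assumes "0 < e" "e \<le> 1" "n \<le> m"
  shows "(\<Sum>k=n+1..m. real k powr (- 1 - e)) \<le> 2 / e * real (n + 1) powr (- e)"
proof -
  have "(\<Sum>k=n+1..m. real k powr (- 1 - e))
      \<le> (\<Sum>k=n+1..m. 2 / e * (real k powr (- e) - real (k + 1) powr (- e)))"
  proof (rule sum_mono)
    fix k assume "k \<in> {n+1..m}"
    thus "real k powr (- 1 - e) \<le> 2 / e * (real k powr (- e) - real (k + 1) powr (- e))"
      using powr_neg_le_diff[of e "real k"] assms by (simp add: add.commute)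
  qed
  also have "\<dots> = 2 / e * (\<Sum>k=n+1..m. real k powr (- e) - real (k + 1) powr (- e))"
    by (rule sum_distrib_left[symmetric])
  also have "(\<Sum>k=n+1..m. real k powr (- e) - real (k + 1) powr (- e))
     = real (n + 1) powr (- e) - real (m + 1) powr (- e)"
    using sum_Suc_diff[of "n+1" m "\<lambda>k. - (real k powr (- e))"] assms by simp
  also have "2 / e * (real (n + 1) powr (- e) - real (m + 1) powr (- e)) \<le> 2 / e * real (n + 1) powr (- e)"
    using assms by (intro mult_left_mono) auto
  finally show ?thesis .
qed

text \<open>The partial sums of the coefficients of \<open>(1 - z)^(-\<theta>)\<close>, in closed
  form Gamma(n + 1 + \<theta>) / (n! Gamma(1 + \<theta>)). They act as the integrating factor of the
  recurrence.\<close>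

definition rise :: "real \<Rightarrow> nat \<Rightarrow> real" where
  "rise \<theta> n = (\<Prod>k=1..n. 1 + \<theta> / real k)"

lemma rise_0 [simp]: "rise \<theta> 0 = 1"
  by (simp add: rise_def)

lemma rise_Suc: "rise \<theta> (Suc n) = rise \<theta> n * (1 + \<theta> / real (Suc n))"
  by (simp add: rise_def)

lemma rise_pos: "0 < \<theta> \<Longrightarrow> 0 < rise \<theta> n"
  unfolding rise_def by (intro prod_pos) (auto intro: add_pos_nonneg)

lemma rise_mono: "0 < \<theta> \<Longrightarrow> m \<le> n \<Longrightarrow> rise \<theta> m \<le> rise \<theta> n"
proof (rule lift_Suc_mono_le[of "rise \<theta>"])
  fix n assume "0 < \<theta>"
  thus "rise \<theta> n \<le> rise \<theta> (Suc n)"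
    using rise_pos[of \<theta> n] by (simp add: rise_Suc)
qed auto

text \<open>The left side telescopes into the factors \<open>(1 + 1 / k) powr \<theta>\<close>, and
  Bernoulli compares each with \<open>1 + \<theta> / k\<close>.\<close>

lemma rise_ge:
  assumes "0 < \<theta>" "\<theta> \<le> 1"
  shows "real (n + 1) powr \<theta> \<le> rise \<theta> n"
proof (induction n)
  case (Suc n)
  have "real (Suc n + 1) powr \<theta> = real (n + 1) powr \<theta> * (1 + 1 / real (Suc n)) powr \<theta>"
    by (subst powr_mult[symmetric]) (auto simp: distrib_left add_divide_distrib[symmetric])
  also have "\<dots> \<le> rise \<theta> n * (1 + \<theta> * (1 / real (Suc n)))"
    by (intro mult_mono Suc powr_one_plus_le) (use assms in \<open>auto intro: less_le_trans[of _ 0] simp: less_imp_le[OF rise_pos]\<close>)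
  finally show ?case by (simp add: rise_Suc)
qed simp

lemma rise_le:
  assumes "0 < \<theta>" "\<theta> \<le> 1"
  shows "rise \<theta> n \<le> \<theta> powr (- \<theta>) * real (n + 1) powr \<theta>"
proof -
  \<comment> \<open>A sharper bound that carries the induction: it is an equality at
    \<open>n = 0\<close>, and with \<open>x = n + \<theta>\<close> Bernoulli gives exactly
    \<open>(n + 1) / (x + 1)\<close>, the inverse of the next factor of \<open>rise\<close>.\<close>
  have "rise \<theta> n \<le> ((real n + \<theta>) / \<theta>) powr \<theta>"
  proof (induction n)
    case (Suc n)
    define x where "x = real n + \<theta>"
    have x: "x > 0" using assms by (simp add: x_def)
    have "(x / (x + 1)) powr \<theta> \<le> 1 - \<theta> / (x + 1)"
      using powr_one_plus_le[of \<theta> "- 1 / (x + 1)"] assms x by (simp add: field_simps)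
    also have "\<dots> = real (Suc n) / (x + 1)" using x by (simp add: field_simps) (simp add: x_def)
    finally have *: "1 + \<theta> / real (Suc n) \<le> ((x + 1) / x) powr \<theta>"
      using x by (simp add: powr_divide field_simps) (simp add: x_def algebra_simps)
    have "rise \<theta> (Suc n) \<le> (x / \<theta>) powr \<theta> * ((x + 1) / x) powr \<theta>"
      unfolding rise_Suc using Suc *
      by (intro mult_mono) (use assms in \<open>auto simp: x_def\<close>)
    also have "\<dots> = ((x + 1) / \<theta>) powr \<theta>"
      using x assms by (subst powr_mult[symmetric]) auto
    finally show ?case by (simp add: x_def add_ac)
  qed (use assms in auto)
  also have "\<dots> \<le> (real (n + 1) / \<theta>) powr \<theta>"
    using assms by (intro powr_mono2 divide_right_mono) auto
  also have "\<dots> = \<theta> powr (- \<theta>) * real (n + 1) powr \<theta>"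
    using assms by (simp add: powr_divide powr_minus field_simps)
  finally show ?thesis .
qed

text \<open>Each unit shift contributes a factor tending to 1. This is the pointwise limit needed
  for Tannery's theorem below.\<close>

lemma rise_ratio_tendsto:
  assumes "0 < \<theta>"
  shows "(\<lambda>n. rise \<theta> (n - k) / rise \<theta> n) \<longlonglongrightarrow> 1"
proof (induction k)
  case 0
  show ?case using rise_pos[OF assms] by (simp add: less_imp_neq[symmetric])
next
  case (Suc k)
  have "(\<lambda>n. 1 / (1 + \<theta> / real (n - k))) \<longlonglongrightarrow> 1"
    by real_asymp
  from tendsto_mult[OF Suc this]
  have "(\<lambda>n. rise \<theta> (n - k) / rise \<theta> n * (1 / (1 + \<theta> / real (n - k)))) \<longlonglongrightarrow> 1"
    by simp
  moreover have "eventually (\<lambda>n. rise \<theta> (n - k) / rise \<theta> n * (1 / (1 + \<theta> / real (n - k)))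
      = rise \<theta> (n - Suc k) / rise \<theta> n) sequentially"
    using eventually_gt_at_top[of k]
  proof eventually_elim
    case (elim n)
    hence "n - k = Suc (n - Suc k)" by simp
    moreover have "1 + \<theta> / real (Suc (n - Suc k)) > 0"
      using assms by (intro add_pos_nonneg) auto
    ultimately show ?case
      by (simp add: rise_Suc)
  qed
  ultimately show ?case by (rule Lim_transform_eventually)
qed

subsection \<open>Exponential series\<close>

text \<open>The operator z d/dz cancels the denominators \<open>j\<close> of the inner series; for
  \<open>F = exp_series c\<close> this is z F' / F.\<close>

abbreviation log_deriv :: "(nat \<Rightarrow> 'a::field_char_0) \<Rightarrow> 'a fps" where
  "log_deriv c \<equiv> Abs_fps (\<lambda>j. if j = 0 then 0 else c j)"

lemma fps_mult_log_deriv_nth: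
  "fps_nth (F * log_deriv c) n = (\<Sum>j=1..n. c j * fps_nth F (n - j))"
proof -
  have "fps_nth (F * log_deriv c) n = fps_nth (log_deriv c * F) n"
    by (simp add: mult.commute)
  also have "\<dots> = (\<Sum>j=0..n. (if j = 0 then 0 else c j) * fps_nth F (n - j))"
    by (simp add: fps_mult_nth)
  also have "\<dots> = (\<Sum>j=1..n. c j * fps_nth F (n - j))"
    by (intro sum.mono_neutral_cong_right) auto
  finally show ?thesis .
qed

lemma fps_X_deriv_nth: "fps_nth (fps_X * fps_deriv F) n = of_nat n * fps_nth F n"
  by (cases n) auto

lemma exp_series_nth_0 [simp]: "fps_nth (exp_series c) 0 = 1"
  by (simp add: exp_series_def)

lemma exp_series_deriv: "fps_X * fps_deriv (exp_series c) = exp_series c * log_deriv c"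
proof -
  have "fps_X * fps_deriv (Abs_fps (\<lambda>j. if j = 0 then 0 else c j / of_nat j)) = log_deriv c"
    by (rule fps_ext) (simp only: fps_X_deriv_nth, simp)
  thus ?thesis
    by (simp add: exp_series_def fps_compose_deriv mult.left_commute)
qed

lemma exp_series_rec:
  "of_nat n * fps_nth (exp_series c) n = (\<Sum>j=1..n. c j * fps_nth (exp_series c) (n - j))"
  by (simp only: fps_X_deriv_nth[symmetric] exp_series_deriv fps_mult_log_deriv_nth)

text \<open>The recurrence determines the coefficients one by one. The range is cut at
  \<open>N\<close> so that series whose weights agree only up to \<open>N\<close> can be
  compared.\<close>

lemma exp_series_nth_unique:
  assumes "u 0 = 1"
    and "\<And>m. 1 \<le> m \<Longrightarrow> m \<le> N \<Longrightarrow> of_nat m * u m = (\<Sum>j=1..m. c j * u (m - j))"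
  shows "n \<le> N \<Longrightarrow> u n = fps_nth (exp_series c) n"
proof (induction n rule: less_induct)
  case (less n)
  show ?case
  proof (cases "n = 0")
    case False
    have "of_nat n * u n = (\<Sum>j=1..n. c j * fps_nth (exp_series c) (n - j))"
      using assms(2)[of n] False less by simp
    also have "\<dots> = of_nat n * fps_nth (exp_series c) n"
      by (rule exp_series_rec[symmetric])
    finally show ?thesis using False by simp
  qed (simp add: assms)
qed

lemma exp_series_cong:
  assumes "\<And>j. 1 \<le> j \<Longrightarrow> j \<le> n \<Longrightarrow> a j = b j"
  shows "fps_nth (exp_series a) n = fps_nth (exp_series b) n"
proof (rule exp_series_nth_unique[of _ n])
  fix m assume m: "1 \<le> m" "m \<le> n"
  show "of_nat m * fps_nth (exp_series a) m = (\<Sum>j=1..m. b j * fps_nth (exp_series a) (m - j))"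
    unfolding exp_series_rec using assms m by (intro sum.cong) auto
qed auto

text \<open>Logarithmic derivatives add under multiplication, and the resulting recurrence has only
  one solution.\<close>

lemma exp_series_add: "exp_series (\<lambda>j. a j + b j) = exp_series a * exp_series b"
proof (rule fps_ext, rule exp_series_nth_unique[symmetric])
  fix m
  have "fps_X * fps_deriv (exp_series a * exp_series b)
     = (fps_X * fps_deriv (exp_series a)) * exp_series b + exp_series a * (fps_X * fps_deriv (exp_series b))"
    by (simp add: algebra_simps)
  also have "\<dots> = (exp_series a * exp_series b) * (log_deriv a + log_deriv b)"
    by (simp only: exp_series_deriv) (simp add: algebra_simps)
  also have "log_deriv a + log_deriv b = log_deriv (\<lambda>j. a j + b j)"
    by (rule fps_ext) simp
  finally show "of_nat m * fps_nth (exp_series a * exp_series b) m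
    = (\<Sum>j=1..m. (a j + b j) * fps_nth (exp_series a * exp_series b) (m - j))"
    by (simp only: fps_X_deriv_nth[symmetric] fps_mult_log_deriv_nth)
qed auto

lemma exp_series_of_real:
  "of_real (fps_nth (exp_series d) n)
    = fps_nth (exp_series (\<lambda>j. of_real (d j)) :: 'a::{real_normed_field, field_char_0} fps) n"
proof (rule exp_series_nth_unique[of _ n])
  fix m
  have "of_nat m * of_real (fps_nth (exp_series d) m) = (of_real (real m * fps_nth (exp_series d) m) :: 'a)"
    by simp
  also have "\<dots> = (\<Sum>j=1..m. of_real (d j) * of_real (fps_nth (exp_series d) (m - j)))"
    unfolding exp_series_rec by simp
  finally show "of_nat m * of_real (fps_nth (exp_series d) m)
    = (\<Sum>j=1..m. of_real (d j) * of_real (fps_nth (exp_series d) (m - j)) :: 'a)" .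
qed auto

lemma exp_series_nonneg:
  fixes e :: "nat \<Rightarrow> real"
  assumes "\<And>j. 1 \<le> j \<Longrightarrow> 0 \<le> e j"
  shows "0 \<le> fps_nth (exp_series e) n"
proof (induction n rule: less_induct)
  case (less n)
  show ?case
  proof (cases "n = 0")
    case False
    have "0 \<le> real n * fps_nth (exp_series e) n"
      unfolding exp_series_rec using less assms by (intro sum_nonneg mult_nonneg_nonneg) auto
    thus ?thesis using False by (simp add: zero_le_mult_iff)
  qed simp
qed

text \<open>Bounding every weight in the recurrence by \<open>D\<close> leaves a sum of distinct
  nonnegative coefficients. Hence no coefficient of large index carries much of the total
  mass.\<close>

lemma exp_series_le_sum:
  fixes e :: "nat \<Rightarrow> real"
  assumes "\<And>j. 1 \<le> j \<Longrightarrow> 0 \<le> e j \<and> e j \<le> D" "1 \<le> n" "n \<le> N"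
  shows "real n * fps_nth (exp_series e) n \<le> D * (\<Sum>k\<le>N. fps_nth (exp_series e) k)"
proof -
  have nn: "0 \<le> fps_nth (exp_series e) k" for k
    using assms by (intro exp_series_nonneg) auto
  have "0 \<le> D" using assms(1)[of 1] by simp
  have "real n * fps_nth (exp_series e) n = (\<Sum>j=1..n. e j * fps_nth (exp_series e) (n - j))"
    by (rule exp_series_rec)
  also have "\<dots> \<le> (\<Sum>j=1..n. D * fps_nth (exp_series e) (n - j))"
    using assms nn by (intro sum_mono mult_right_mono) auto
  also have "\<dots> = D * (\<Sum>k\<in>(\<lambda>j. n - j) ` {1..n}. fps_nth (exp_series e) k)"
    by (subst sum.reindex) (auto simp: sum_distrib_left inj_on_def)
  also have "\<dots> \<le> D * (\<Sum>k\<le>N. fps_nth (exp_series e) k)"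
    using assms \<open>0 \<le> D\<close> nn by (intro mult_left_mono sum_mono2) auto
  finally show ?thesis .
qed

section \<open>The binomial series \<open>(1 - z)^(-\<theta>)\<close>\<close>

abbreviation binom_series :: "real \<Rightarrow> 'a::{real_normed_field, field_char_0} fps" where
  "binom_series \<theta> \<equiv> exp_series (\<lambda>_. of_real \<theta>)"

lemma sum_rev_lessThan: "(\<Sum>j=1..n. f (n - j)) = (\<Sum>k<n. f k :: 'a::comm_monoid_add)" for n :: nat
  by (rule sum.reindex_bij_witness[of _ "\<lambda>k. n - k" "\<lambda>j. n - j"]) auto

lemma binom_series_rec:
  "real n * fps_nth (binom_series \<theta>) n = \<theta> * (\<Sum>k<n. fps_nth (binom_series \<theta>) k)"
  unfolding exp_series_rec
  by (simp only: of_real_eq_id id_apply sum_distrib_left[symmetric] sum_rev_lessThan)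

lemma sum_binom_series: "(\<Sum>k\<le>n. fps_nth (binom_series \<theta> :: real fps) k) = rise \<theta> n"
proof (induction n)
  case (Suc n)
  have "real (Suc n) * fps_nth (binom_series \<theta>) (Suc n) = \<theta> * rise \<theta> n"
    using Suc by (simp only: binom_series_rec lessThan_Suc_atMost)
  hence "fps_nth (binom_series \<theta>) (Suc n) = rise \<theta> n * (\<theta> / real (Suc n))"
    by (simp add: field_simps)
  thus ?case using Suc by (simp add: rise_Suc distrib_left)
qed simp

lemma binom_series_Suc:
  "fps_nth (binom_series \<theta> :: real fps) (Suc n) = rise \<theta> n * (\<theta> / real (Suc n))"
  using sum_binom_series[of \<theta> "Suc n"] sum_binom_series[of \<theta> n]
  by (simp add: rise_Suc distrib_left)

lemma binom_series_eq:
  assumes "0 < \<theta>"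
  shows "fps_nth (binom_series \<theta> :: real fps) n = rise \<theta> n * (\<theta> / (real n + \<theta>))"
proof (cases n)
  case 0
  thus ?thesis using assms by simp
next
  case (Suc k)
  have "1 + \<theta> / real (Suc k) = (real (Suc k) + \<theta>) / real (Suc k)"
    by (simp add: field_simps)
  thus ?thesis using assms unfolding Suc binom_series_Suc rise_Suc by simp
qed

text \<open>Combines the bounds on \<open>rise\<close> with the fact that
  \<open>\<theta> / (n + \<theta>)\<close> lies between \<open>\<theta> / (n + 1)\<close> and
  \<open>1 / (n + 1)\<close>.\<close>

lemma binom_series_bounds:
  assumes "0 < \<theta>" "\<theta> \<le> 1"
  shows "\<theta> * real (n + 1) powr (\<theta> - 1) \<le> fps_nth (binom_series \<theta> :: real fps) n"
    and "fps_nth (binom_series \<theta> :: real fps) n \<le> \<theta> powr (- \<theta>) * real (n + 1) powr (\<theta> - 1)"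
proof -
  have eq: "real (n + 1) powr (\<theta> - 1) = real (n + 1) powr \<theta> / real (n + 1)"
    by (simp add: powr_diff)
  have "\<theta> * real (n + 1) powr (\<theta> - 1) = real (n + 1) powr \<theta> * (\<theta> / real (n + 1))"
    unfolding eq by simp
  also have "\<dots> \<le> rise \<theta> n * (\<theta> / (real n + \<theta>))"
    using assms rise_ge[of \<theta> n] rise_pos[of \<theta> n] by (intro mult_mono divide_left_mono) auto
  finally show "\<theta> * real (n + 1) powr (\<theta> - 1) \<le> fps_nth (binom_series \<theta>) n"
    by (simp only: binom_series_eq[OF assms(1)])
  have "\<theta> / (real n + \<theta>) \<le> 1 / real (n + 1)"
    using assms mult_right_mono[of \<theta> 1 "real n"] by (simp add: field_simps)
  hence "rise \<theta> n * (\<theta> / (real n + \<theta>)) \<le> \<theta> powr (- \<theta>) * real (n + 1) powr \<theta> * (1 / real (n + 1))"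
    using assms rise_le[of \<theta> n] rise_pos[of \<theta> n] by (intro mult_mono) auto
  thus "fps_nth (binom_series \<theta>) n \<le> \<theta> powr (- \<theta>) * real (n + 1) powr (\<theta> - 1)"
    unfolding eq binom_series_eq[OF assms(1)] by simp
qed

text \<open>The product rule. Because the weight \<theta> is constant, its convolution collapses to
  a plain partial sum, so the past enters through a single number besides the source term.\<close>

lemma binom_series_mult_rec:
  fixes Q W :: "'a::{real_normed_field, field_char_0} fps"
  assumes "fps_X * fps_deriv Q = W * log_deriv c"
  shows "of_nat n * fps_nth (binom_series \<theta> * Q) n
    = of_real \<theta> * (\<Sum>k<n. fps_nth (binom_series \<theta> * Q) k)
      + (\<Sum>j=1..n. c j * fps_nth (binom_series \<theta> * W) (n - j))"
proof -
  have "fps_X * fps_deriv (binom_series \<theta> * Q)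
     = (fps_X * fps_deriv (binom_series \<theta>)) * Q + binom_series \<theta> * (fps_X * fps_deriv Q)"
    by (simp add: algebra_simps)
  also have "\<dots> = (binom_series \<theta> * Q) * log_deriv (\<lambda>_. of_real \<theta>) + (binom_series \<theta> * W) * log_deriv c"
    by (simp only: exp_series_deriv assms) (simp add: algebra_simps)
  finally have "of_nat n * fps_nth (binom_series \<theta> * Q) n
     = fps_nth ((binom_series \<theta> * Q) * log_deriv (\<lambda>_. of_real \<theta>) + (binom_series \<theta> * W) * log_deriv c) n"
    by (simp only: fps_X_deriv_nth[symmetric])
  thus ?thesis
    by (simp only: fps_add_nth fps_mult_log_deriv_nth sum_distrib_left[symmetric] sum_rev_lessThan)
qed

subsection \<open>A recurrence with constant weight\<close>

text \<open>Used with \<open>x = N / k\<close>: it merges the ranges \<open>k < N\<close> and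
  \<open>k \<ge> N\<close> into the single power \<open>(N / k) powr e\<close>, which makes the
  later increments summable to infinity.\<close>

lemma min_mult_powr_le:
  fixes x e :: real
  assumes "0 < x" "0 < e" "e \<le> 1"
  shows "min 1 x * (1 + x powr e) \<le> 2 * x powr e"
proof (cases "x \<le> 1")
  case True
  have "x powr 1 \<le> x powr e" using True assms by (intro powr_mono') auto
  moreover have "x * x powr e \<le> 1 * x powr e" using True by (intro mult_right_mono) auto
  ultimately have "x * (1 + x powr e) \<le> 2 * x powr e"
    using assms by (simp only: distrib_left powr_one)
  thus ?thesis using True by simp
next
  case False
  hence "1 \<le> x powr e" using assms by (intro ge_one_powr_ge_zero) auto
  thus ?thesis using False by simp
qed

lemma powr_nat_le_double:
  fixes a :: real
  assumes "0 \<le> a" "a \<le> 1" "1 \<le> n"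
  shows "real n powr (- a) \<le> 2 * real (n + 1) powr (- a)"
proof -
  have "real n powr (- a) = (real (n + 1) / real n) powr a * real (n + 1) powr (- a)"
    using assms by (simp add: powr_divide powr_minus_divide)
  also have "(real (n + 1) / real n) powr a \<le> 2 powr a"
    using assms by (intro powr_mono2) (auto simp: field_simps)
  also have "2 powr a \<le> (2::real) powr 1" using assms by (intro powr_mono) auto
  finally show ?thesis by (simp add: mult_right_mono)
qed

text \<open>\<open>V\<close> and \<open>U\<close> stand for the coefficients of
  \<open>(1 - z)^(-\<theta>)\<close> times \<Phi>(D) and \<Phi>'(D), and \<open>l\<close> for
  \<Phi>(0). The weights enter only through \<open>conv\<close>, whose factor \<open>min k N\<close>
  reflects that \<open>c\<close> lives on indices up to \<open>N\<close>. The two-term profile for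
  \<open>U\<close> is chosen so that the bound derived for \<open>V\<close> has the same shape and
  can be fed back.\<close>

locale weighted_recurrence =
  fixes \<theta> \<epsilon> \<eta> A :: real and N :: nat and c U V :: "nat \<Rightarrow> complex" and l :: complex
  assumes theta: "0 < \<theta>" "\<theta> \<le> 1" and eps: "0 < \<epsilon>" "\<epsilon> \<le> 1" and N: "1 \<le> N"
    and A: "0 \<le> A" and eta: "0 \<le> \<eta>"
    and rec: "\<And>n. 1 \<le> n \<Longrightarrow>
      of_nat n * V n = of_real \<theta> * (\<Sum>k<n. V k) + (\<Sum>j=1..n. c j * U (n - j))"
    and lim: "(\<lambda>n. (\<Sum>k\<le>n. V k) / of_real (rise \<theta> n)) \<longlonglongrightarrow> l"
    and conv: "\<And>k \<alpha>. 1 \<le> k \<Longrightarrow> \<alpha> \<in> {1 - \<theta>, 1 - \<theta> + \<epsilon>} \<Longrightarrow>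
      (\<Sum>j=1..k. cmod (c j) * real (k - j + 1) powr (- \<alpha>)) \<le> \<eta> * min (real k) (real N) * real k powr (- \<alpha>)"
    and U: "\<And>i. cmod (U i) \<le> A * (real (i + 1) powr (\<theta> - 1)
      + real N powr \<epsilon> * real (i + 1) powr (\<theta> - 1 - \<epsilon>))"
begin

definition R :: "nat \<Rightarrow> complex" where "R k = (\<Sum>j=1..k. c j * U (k - j))"
definition S :: "nat \<Rightarrow> complex" where "S n = (\<Sum>k\<le>n. V k)"

lemma R_bound:
  assumes k: "1 \<le> k"
  shows "cmod (R k) \<le> 2 * (\<eta> * A * real N powr \<epsilon> * real k powr (\<theta> - \<epsilon>))"
proof -
  let ?w = "\<lambda>\<alpha>. \<Sum>j=1..k. cmod (c j) * real (k - j + 1) powr (- \<alpha>)"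
  have "cmod (R k) \<le> (\<Sum>j=1..k. cmod (c j) * (A * (real (k - j + 1) powr (\<theta> - 1)
      + real N powr \<epsilon> * real (k - j + 1) powr (\<theta> - 1 - \<epsilon>))))"
    unfolding R_def by (rule sum_norm_le) (simp only: norm_mult, intro mult_left_mono U norm_ge_zero)
  also have "\<dots> = A * (?w (1 - \<theta>) + real N powr \<epsilon> * ?w (1 - \<theta> + \<epsilon>))"
    by (simp add: sum_distrib_left sum.distrib distrib_left mult_ac add_diff_eq diff_diff_eq2)
  also have "\<dots> \<le> A * (\<eta> * min (real k) (real N) * real k powr (- (1 - \<theta>))
      + real N powr \<epsilon> * (\<eta> * min (real k) (real N) * real k powr (- (1 - \<theta> + \<epsilon>))))"
    using A k by (intro mult_left_mono add_mono conv) auto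
  \<comment> \<open>Both terms share the factor \<open>k powr \<theta> * min 1 (N / k)\<close>,
    which prepares \<open>min_mult_powr_le\<close>.\<close>
  also have "\<dots> = \<eta> * A * (real k powr \<theta> * (min 1 (real N / real k) * (1 + (real N / real k) powr \<epsilon>)))"
  proof -
    have "min (real k) (real N) = real k * min 1 (real N / real k)"
      using k by (simp add: min_def field_simps)
    moreover have "real k powr (- (1 - \<theta>)) = real k powr \<theta> / real k"
      using k by (simp add: powr_diff)
    moreover have "real k powr (- (1 - \<theta> + \<epsilon>)) = real k powr \<theta> / real k / real k powr \<epsilon>"
      using k by (simp add: powr_diff powr_add)
    moreover have "(real N / real k) powr \<epsilon> = real N powr \<epsilon> / real k powr \<epsilon>"
      by (simp add: powr_divide)
    ultimately show ?thesis using k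
      by (simp only:) (simp add: field_simps)
  qed
  also have "\<dots> \<le> \<eta> * A * (real k powr \<theta> * (2 * (real N / real k) powr \<epsilon>))"
    using A eta eps k N by (intro mult_left_mono min_mult_powr_le) auto
  also have "\<dots> = 2 * (\<eta> * A * real N powr \<epsilon> * real k powr (\<theta> - \<epsilon>))"
    using k by (simp add: powr_divide powr_diff)
  finally show ?thesis .
qed

text \<open>The recurrence reads \<open>S k = S (k - 1) * (1 + \<theta> / k) + R k / k\<close>, and
  \<open>rise\<close> has the same factor, so division removes the homogeneous part.\<close>

lemma S_step:
  assumes k: "1 \<le> k"
  shows "S k / of_real (rise \<theta> k) - S (k - 1) / of_real (rise \<theta> (k - 1))
     = R k / (of_nat k * of_real (rise \<theta> k))"
proof -
  obtain n where n: "k = Suc n" using k by (cases k) auto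
  have "of_nat k * V k = of_real \<theta> * S n + R k"
    using rec[OF k] by (simp add: S_def R_def n lessThan_Suc_atMost)
  hence "of_nat k * S k = of_nat k * S n + of_real \<theta> * S n + R k"
    by (simp add: S_def n algebra_simps)
  hence 1: "S k = S n * of_real (1 + \<theta> / real k) + R k / of_nat k"
    using k by (simp add: field_simps)
  have pos: "rise \<theta> n > 0" "1 + \<theta> / real k > 0"
    using rise_pos theta k by (auto intro: add_pos_nonneg)
  have 2: "rise \<theta> k = rise \<theta> n * (1 + \<theta> / real k)"
    by (simp add: n rise_Suc)
  have nz: "complex_of_real (1 + \<theta> / real k) \<noteq> 0" "complex_of_real (rise \<theta> n) \<noteq> 0"
    using pos by (auto simp only: of_real_eq_0_iff)
  have "S k / of_real (rise \<theta> k) = S n / of_real (rise \<theta> n) + R k / of_nat k / of_real (rise \<theta> k)"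
    unfolding 1 add_divide_distrib unfolding 2 of_real_mult using nz by simp
  thus ?thesis by (simp add: n)
qed

text \<open>The increments are of order \<open>k powr (- 1 - \<epsilon>)\<close>. They are summed
  from infinity, where the value \<open>l\<close> is known, so the whole deviation from
  \<open>l\<close> carries the factor \<eta>.\<close>

lemma S_dist:
  "cmod (S n / of_real (rise \<theta> n) - l) \<le> 4 / \<epsilon> * (\<eta> * A * real N powr \<epsilon> * real (n + 1) powr (- \<epsilon>))"
proof -
  let ?u = "\<lambda>n. S n / of_real (rise \<theta> n)"
  have fin: "cmod (?u n - ?u m) \<le> 4 / \<epsilon> * (\<eta> * A * real N powr \<epsilon> * real (n + 1) powr (- \<epsilon>))"
    if "n \<le> m" for m
  proof -
    have "?u m - ?u n = (\<Sum>k=n+1..m. ?u k - ?u (k - 1))"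
      using that
    proof (induction m rule: dec_induct)
      case (step m)
      thus ?case by (simp add: algebra_simps)
    qed simp
    also have "\<dots> = (\<Sum>k=n+1..m. R k / (of_nat k * of_real (rise \<theta> k)))"
      by (intro sum.cong S_step) auto
    also have "cmod \<dots> \<le> (\<Sum>k=n+1..m. 2 * (\<eta> * A * real N powr \<epsilon>) * real k powr (- 1 - \<epsilon>))"
    proof (rule sum_norm_le)
      fix k assume "k \<in> {n+1..m}"
      hence k: "1 \<le> k" by simp
      have rk: "real k powr \<theta> \<le> rise \<theta> k"
        using powr_mono2[of \<theta> "real k" "real (k + 1)"] rise_ge[of \<theta> k] theta by simp
      have "cmod (R k / (of_nat k * of_real (rise \<theta> k))) = cmod (R k) / (real k * rise \<theta> k)"
        using rise_pos[of \<theta> k] theta by (simp add: norm_divide norm_mult)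
      also have "\<dots> \<le> 2 * (\<eta> * A * real N powr \<epsilon> * real k powr (\<theta> - \<epsilon>)) / (real k * real k powr \<theta>)"
        using R_bound[OF k] rk k A eta by (intro frac_le mult_left_mono) auto
      also have "real k * real k powr \<theta> = real k powr (1 + \<theta>)"
        using k by (simp add: powr_add)
      also have "2 * (\<eta> * A * real N powr \<epsilon> * real k powr (\<theta> - \<epsilon>)) / real k powr (1 + \<theta>)
        = 2 * (\<eta> * A * real N powr \<epsilon>) * (real k powr (\<theta> - \<epsilon>) / real k powr (1 + \<theta>))"
        by simp
      also have "real k powr (\<theta> - \<epsilon>) / real k powr (1 + \<theta>) = real k powr (- 1 - \<epsilon>)"
        by (simp add: powr_diff[symmetric] minus_diff_commute)
      finally show "cmod (R k / (of_nat k * of_real (rise \<theta> k)))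
        \<le> 2 * (\<eta> * A * real N powr \<epsilon>) * real k powr (- 1 - \<epsilon>)" .
    qed
    also have "\<dots> = 2 * (\<eta> * A * real N powr \<epsilon>) * (\<Sum>k=n+1..m. real k powr (- 1 - \<epsilon>))"
      by (rule sum_distrib_left[symmetric])
    also have "\<dots> \<le> 2 * (\<eta> * A * real N powr \<epsilon>) * (2 / \<epsilon> * real (n + 1) powr (- \<epsilon>))"
      using A eta eps that by (intro mult_left_mono sum_powr_tail_le) auto
    finally show ?thesis by (subst norm_minus_commute) (simp add: mult_ac)
  qed
  have "(\<lambda>m. cmod (?u n - ?u m)) \<longlonglongrightarrow> cmod (?u n - l)"
    using lim unfolding S_def by (intro tendsto_intros)
  thus ?thesis
    by (rule tendsto_upperbound) (use fin in \<open>auto simp: eventually_at_top_linorder\<close>)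
qed

lemma S_bound:
  "cmod (S n) \<le> rise \<theta> n * (cmod l + 4 / \<epsilon> * (\<eta> * A * real N powr \<epsilon> * real (n + 1) powr (- \<epsilon>)))"
proof -
  let ?u = "S n / of_real (rise \<theta> n)"
  have "cmod ?u \<le> cmod l + cmod (?u - l)" by norm
  also note S_dist
  finally show ?thesis
    using rise_pos[of \<theta> n] theta by (simp add: norm_divide pos_divide_le_eq mult.commute)
qed

text \<open>A coefficient is recovered from \<open>n * V n = \<theta> * S (n - 1) + R n\<close>.
  Only the term with \<open>l\<close> is free of \<eta>.\<close>

lemma V_bound:
  "cmod (V n) \<le> (4 * (\<theta> powr (- \<theta>) * (4 / \<epsilon>) + 2)) * real (n + 1) powr (\<theta> - 1)
     * (cmod l + \<eta> * A * real N powr \<epsilon> * real (n + 1) powr (- \<epsilon>))"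
proof -
  define B where "B = \<eta> * A * real N powr \<epsilon>"
  \<comment> \<open>The three numbers come from \<open>rise_le\<close>, \<open>S_dist\<close> and
    \<open>R_bound\<close>; the outer factor 4 pays for replacing \<open>n\<close> by
    \<open>n + 1\<close> in two powers.\<close>
  define K where "K = \<theta> powr (- \<theta>) * (4 / \<epsilon>) + 2"
  have B: "0 \<le> B" using A eta by (simp add: B_def)
  have e4: "1 \<le> 4 / \<epsilon>" using eps by (simp add: field_simps)
  have "1 \<le> (1 / \<theta>) powr \<theta>" using theta by (intro ge_one_powr_ge_zero) auto
  hence tt: "1 \<le> \<theta> powr (- \<theta>)" using theta by (simp add: powr_divide powr_minus field_simps)
  have tK: "\<theta> powr (- \<theta>) \<le> K" and eK: "4 / \<epsilon> \<le> K" and K1: "1 \<le> K"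
    using mult_mono[OF order.refl e4, of "\<theta> powr (- \<theta>)"] mult_mono[OF tt order.refl, of "4 / \<epsilon>"] tt e4
    unfolding K_def by linarith+
  show ?thesis
  proof (cases "n = 0")
    case True
    \<comment> \<open>The recurrence starts at 1; at 0 one has \<open>V 0 = S 0\<close>.\<close>
    have "cmod (V 0) \<le> cmod l + 4 / \<epsilon> * B"
      using S_bound[of 0] by (simp add: S_def B_def)
    also have "\<dots> \<le> K * cmod l + K * B"
      using K1 eK B mult_right_mono[OF K1, of "cmod l"] by (intro add_mono mult_right_mono) auto
    also have "\<dots> \<le> 4 * (K * (cmod l + B))"
      using K1 B mult_nonneg_nonneg[of K "cmod l + B"] by (simp add: distrib_left)
    finally show ?thesis using True unfolding B_def[symmetric] K_def[symmetric] by simp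
  next
    case False
    hence n: "1 \<le> n" by simp
    define X where "X = B * real n powr (- \<epsilon>)"
    have X: "0 \<le> X" using B by (simp add: X_def)
    have S: "cmod (S (n - 1)) \<le> (\<theta> powr (- \<theta>) * real n powr \<theta>) * (cmod l + 4 / \<epsilon> * X)"
    proof -
      have "cmod (S (n - 1)) \<le> rise \<theta> (n - 1) * (cmod l + 4 / \<epsilon> * X)"
        using S_bound[of "n - 1"] n by (simp add: X_def B_def)
      also have "\<dots> \<le> (\<theta> powr (- \<theta>) * real n powr \<theta>) * (cmod l + 4 / \<epsilon> * X)"
        using rise_le[OF theta, of "n - 1"] n X eps by (intro mult_right_mono) auto
      finally show ?thesis .
    qed
    have R: "cmod (R n) \<le> real n powr \<theta> * (2 * X)"
      using R_bound[OF n] by (simp add: X_def B_def powr_diff powr_minus divide_inverse mult_ac)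
    have "{..<n} = {..n - 1}" using n by auto
    hence "of_nat n * V n = of_real \<theta> * S (n - 1) + R n"
      using rec[OF n] by (simp add: S_def R_def)
    hence "real n * cmod (V n) \<le> \<theta> * cmod (S (n - 1)) + cmod (R n)"
      using theta norm_triangle_ineq[of "of_real \<theta> * S (n - 1)" "R n"]
      by (metis abs_of_pos norm_mult norm_of_nat norm_of_real)
    also have "\<dots> \<le> 1 * ((\<theta> powr (- \<theta>) * real n powr \<theta>) * (cmod l + 4 / \<epsilon> * X)) + real n powr \<theta> * (2 * X)"
      using theta S R by (intro add_mono mult_mono) auto
    also have "\<dots> = real n powr \<theta> * (\<theta> powr (- \<theta>) * cmod l + K * X)"
      by (simp add: K_def algebra_simps)
    also have "\<dots> \<le> real n powr \<theta> * (K * cmod l + K * X)"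
      using tK by (intro mult_left_mono add_right_mono mult_right_mono) auto
    finally have "cmod (V n) \<le> real n powr \<theta> / real n * (K * (cmod l + X))"
      using n by (simp add: field_simps)
    also have "real n powr \<theta> / real n = real n powr (- (1 - \<theta>))"
      using n by (simp add: powr_diff)
    also have "real n powr (- (1 - \<theta>)) * (K * (cmod l + X))
      \<le> (2 * real (n + 1) powr (- (1 - \<theta>))) * (K * (2 * (cmod l + B * real (n + 1) powr (- \<epsilon>))))"
    proof (intro mult_mono)
      show "real n powr (- (1 - \<theta>)) \<le> 2 * real (n + 1) powr (- (1 - \<theta>))"
        using theta n by (intro powr_nat_le_double) auto
      have "X \<le> B * (2 * real (n + 1) powr (- \<epsilon>))"
        unfolding X_def using eps n B by (intro mult_left_mono powr_nat_le_double) auto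
      thus "cmod l + X \<le> 2 * (cmod l + B * real (n + 1) powr (- \<epsilon>))"
        using norm_ge_zero[of l] by (simp only: distrib_left)
    qed (use K1 X in auto)
    finally show ?thesis
      unfolding B_def[symmetric] K_def[symmetric] by (simp add: algebra_simps)
  qed
qed

end

subsection \<open>Multiplication by the binomial series\<close>

text \<open>Exchanging the summations replaces the binomial coefficients by their partial sums
  \<open>rise\<close>. These are monotone, which supplies the domination in the next lemma.\<close>

lemma sum_binom_mult:
  fixes Q :: "complex fps"
  shows "(\<Sum>k\<le>n. fps_nth (binom_series \<theta> * Q) k) = (\<Sum>k\<le>n. fps_nth Q k * of_real (rise \<theta> (n - k)))"
proof -
  have "(\<Sum>k\<le>n. fps_nth (binom_series \<theta> * Q) k)
     = (\<Sum>k\<le>n. \<Sum>i\<le>k. fps_nth Q i * of_real (fps_nth (binom_series \<theta> :: real fps) (k - i)))"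
    by (subst mult.commute) (simp add: fps_mult_nth atLeast0AtMost exp_series_of_real)
  also have "\<dots> = (\<Sum>i\<le>n. \<Sum>k=i..n. fps_nth Q i * of_real (fps_nth (binom_series \<theta> :: real fps) (k - i)))"
    by (subst sum.Sigma, simp, simp, subst sum.Sigma, simp, simp,
        rule sum.reindex_bij_witness[of _ "\<lambda>(i, k). (k, i)" "\<lambda>(k, i). (i, k)"]) auto
  also have "\<dots> = (\<Sum>i\<le>n. fps_nth Q i * of_real (rise \<theta> (n - i)))"
  proof (rule sum.cong, simp)
    fix i assume i: "i \<in> {..n}"
    have "(\<Sum>k=i..n. fps_nth Q i * of_real (fps_nth (binom_series \<theta> :: real fps) (k - i)))
      = fps_nth Q i * of_real (\<Sum>k=i..n. fps_nth (binom_series \<theta> :: real fps) (k - i))"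
      by (simp add: sum_distrib_left)
    also have "(\<Sum>k=i..n. fps_nth (binom_series \<theta> :: real fps) (k - i))
      = (\<Sum>k\<le>n - i. fps_nth (binom_series \<theta> :: real fps) k)"
      using i by (intro sum.reindex_bij_witness[of _ "\<lambda>k. k + i" "\<lambda>k. k - i"]) auto
    also note sum_binom_series
    finally show "(\<Sum>k=i..n. fps_nth Q i * of_real (fps_nth (binom_series \<theta> :: real fps) (k - i)))
      = fps_nth Q i * of_real (rise \<theta> (n - i))" .
  qed
  finally show ?thesis .
qed

text \<open>Tannery's theorem: each ratio \<open>rise \<theta> (n - k) / rise \<theta> n\<close>
  tends to 1 and never exceeds 1, so the coefficients of \<open>Q\<close> themselves
  dominate.\<close>

lemma sum_binom_mult_tendsto:
  fixes Q :: "complex fps"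
  assumes "0 < \<theta>" and Q: "summable (\<lambda>k. cmod (fps_nth Q k))" "fps_nth Q sums l"
  shows "(\<lambda>n. (\<Sum>k\<le>n. fps_nth (binom_series \<theta> * Q) k) / of_real (rise \<theta> n)) \<longlonglongrightarrow> l"
proof -
  \<comment> \<open>Set to 0 beyond \<open>n\<close>, where truncated subtraction would produce the
    spurious value \<open>rise \<theta> 0\<close>.\<close>
  define a where "a k n = (if k \<le> n then fps_nth Q k * of_real (rise \<theta> (n - k) / rise \<theta> n) else 0)" for k n
  have pos: "rise \<theta> n > 0" for n using rise_pos assms(1) .
  have lim: "(\<lambda>n. a k n) \<longlonglongrightarrow> fps_nth Q k" for k
  proof (rule Lim_transform_eventually)
    show "(\<lambda>n. fps_nth Q k * of_real (rise \<theta> (n - k) / rise \<theta> n)) \<longlonglongrightarrow> fps_nth Q k"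
      using tendsto_mult[OF tendsto_const[of "fps_nth Q k"] tendsto_of_real[OF rise_ratio_tendsto[OF assms(1), of k]]]
      by simp
    show "eventually (\<lambda>n. fps_nth Q k * of_real (rise \<theta> (n - k) / rise \<theta> n) = a k n) sequentially"
      using eventually_ge_at_top[of k] by eventually_elim (simp add: a_def)
  qed
  have bound: "cmod (a k n) \<le> cmod (fps_nth Q k)" for k n
  proof (cases "k \<le> n")
    case True
    have "rise \<theta> (n - k) / rise \<theta> n \<le> 1"
      using rise_mono[OF assms(1), of "n - k" n] pos[of n] by simp
    moreover have "0 \<le> rise \<theta> (n - k) / rise \<theta> n"
      using pos by (simp add: less_imp_le)
    ultimately have "cmod (of_real (rise \<theta> (n - k) / rise \<theta> n)) \<le> 1"
      by (simp only: norm_of_real abs_of_nonneg)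
    from mult_left_mono[OF this, of "cmod (fps_nth Q k)"] show ?thesis
      using True by (simp add: a_def norm_mult del: of_real_divide)
  qed (simp add: a_def)
  have "(\<lambda>n. suminf (\<lambda>k. a k n)) \<longlonglongrightarrow> suminf (fps_nth Q)"
  proof -
    have "eventually (\<lambda>(k, n). cmod (a k n) \<le> cmod (fps_nth Q k)) (at_top \<times>\<^sub>F sequentially)"
      using bound by (intro always_eventually) auto
    from tannerys_theorem[OF lim this Q(1)] show ?thesis by simp
  qed
  moreover have "suminf (\<lambda>k. a k n) = (\<Sum>k\<le>n. fps_nth (binom_series \<theta> * Q) k) / of_real (rise \<theta> n)" for n
  proof -
    have "suminf (\<lambda>k. a k n) = (\<Sum>k\<le>n. a k n)"
      by (rule suminf_finite) (auto simp: a_def)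
    thus ?thesis by (simp add: a_def sum_binom_mult sum_divide_distrib)
  qed
  ultimately show ?thesis using Q(2) by (simp add: sums_iff)
qed

text \<open>A qualitative bound whose constant depends on \<open>Q\<close>. It serves only to make a
  supremum finite before that supremum is estimated.\<close>

lemma binom_mult_bounded:
  fixes Q :: "complex fps"
  assumes "0 < \<theta>" "\<theta> \<le> 1" and Q: "summable (\<lambda>k. cmod (fps_nth Q k) * real (k + 1))"
  shows "\<exists>A\<ge>0. \<forall>n. cmod (fps_nth (binom_series \<theta> * Q) n) \<le> A * real (n + 1) powr (\<theta> - 1)"
proof -
  define s where "s = (\<Sum>k. cmod (fps_nth Q k) * real (k + 1))"
  define K where "K = \<theta> powr (- \<theta>)"
  have "0 \<le> s" unfolding s_def by (intro suminf_nonneg Q) simp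
  have "0 \<le> K" by (simp add: K_def)
  have "cmod (fps_nth (binom_series \<theta> * Q) n) \<le> K * s * real (n + 1) powr (\<theta> - 1)" for n
  proof -
    have "fps_nth (binom_series \<theta> * Q) n
       = (\<Sum>k\<le>n. fps_nth Q k * of_real (fps_nth (binom_series \<theta> :: real fps) (n - k)))"
      by (subst mult.commute) (simp add: fps_mult_nth atLeast0AtMost exp_series_of_real)
    hence "cmod (fps_nth (binom_series \<theta> * Q) n)
       \<le> (\<Sum>k\<le>n. cmod (fps_nth Q k) * cmod (of_real (fps_nth (binom_series \<theta> :: real fps) (n - k))))"
      by (simp only: norm_mult[symmetric] norm_sum)
    also have "\<dots> \<le> (\<Sum>k\<le>n. cmod (fps_nth Q k) * (real (k + 1) * (K * real (n + 1) powr (\<theta> - 1))))"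
    proof (intro sum_mono mult_left_mono)
      fix k assume k: "k \<in> {..n}"
      define m where "m = n - k"
      \<comment> \<open>This moves the power from index \<open>n - k\<close> to \<open>n\<close> at
        the price of a factor at most \<open>k + 1\<close>, paid by the weighted summability of
        \<open>Q\<close>.\<close>
      have "real (n + 1) \<le> real (m + 1) * real (k + 1)"
        using k by (simp add: m_def of_nat_diff algebra_simps mult_left_mono)
      hence "real (n + 1) powr (1 - \<theta>) \<le> (real (m + 1) * real (k + 1)) powr (1 - \<theta>)"
        using assms by (intro powr_mono2) auto
      also have "\<dots> = real (m + 1) powr (1 - \<theta>) * real (k + 1) powr (1 - \<theta>)"
        by (rule powr_mult)
      also have "\<dots> \<le> real (m + 1) powr (1 - \<theta>) * real (k + 1)"
        using assms powr_mono[of "1 - \<theta>" 1 "real (k + 1)"] by (intro mult_left_mono) auto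
      finally have "real (m + 1) powr (\<theta> - 1) \<le> real (k + 1) * real (n + 1) powr (\<theta> - 1)"
      proof -
        assume le: "real (n + 1) powr (1 - \<theta>) \<le> real (m + 1) powr (1 - \<theta>) * real (k + 1)"
        have eq: "real (i + 1) powr (\<theta> - 1) = 1 / real (i + 1) powr (1 - \<theta>)" for i
          using powr_minus_divide[of "real (i + 1)" "1 - \<theta>"] by simp
        have inv: "1 / y \<le> z * (1 / x)" if "x \<le> y * z" "0 < x" "0 < y" for x y z :: real
          using that by (simp add: field_simps)
        show ?thesis
          unfolding eq by (rule inv[OF le]) auto
      qed
      hence "K * real (m + 1) powr (\<theta> - 1) \<le> K * (real (k + 1) * real (n + 1) powr (\<theta> - 1))"
        using \<open>0 \<le> K\<close> by (intro mult_left_mono) auto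
      moreover have "0 \<le> fps_nth (binom_series \<theta> :: real fps) m"
        using assms by (intro exp_series_nonneg) auto
      ultimately show "cmod (of_real (fps_nth (binom_series \<theta> :: real fps) (n - k)))
          \<le> real (k + 1) * (K * real (n + 1) powr (\<theta> - 1))"
        using binom_series_bounds(2)[OF assms(1,2), of m]
        unfolding m_def[symmetric] K_def[symmetric] norm_of_real by (simp only: mult.left_commute)
    qed auto
    also have "\<dots> = K * real (n + 1) powr (\<theta> - 1) * (\<Sum>k\<le>n. cmod (fps_nth Q k) * real (k + 1))"
      by (simp add: sum_distrib_left mult_ac)
    also have "\<dots> \<le> K * real (n + 1) powr (\<theta> - 1) * s"
      unfolding s_def using \<open>0 \<le> K\<close> Q by (intro mult_left_mono sum_le_suminf) auto
    finally show ?thesis by (simp add: mult_ac)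
  qed
  thus ?thesis using \<open>0 \<le> s\<close> \<open>0 \<le> K\<close> by (intro exI[of _ "K * s"]) auto
qed

text \<open>Finitely many weights make the inner series a polynomial, so its exponential is entire
  and the expansion converges everywhere, in particular at 1.\<close>

lemma exp_series_entire:
  fixes c :: "nat \<Rightarrow> complex"
  assumes c: "\<And>j. N < j \<Longrightarrow> c j = 0"
  shows "fps_nth (exp_series c) sums exp (\<Sum>j=1..N. c j / of_nat j)"
    and "summable (\<lambda>k. cmod (fps_nth (exp_series c) k) * real (k + 1))"
proof -
  let ?g = "\<lambda>z. \<Sum>j=1..N. c j / of_nat j * z ^ j"
  have "?g has_fps_expansion (\<Sum>j=1..N. fps_const (c j / of_nat j) * fps_X ^ j)"
    by (intro fps_expansion_intros)
  also have "(\<Sum>j=1..N. fps_const (c j / of_nat j) * fps_X ^ j)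
     = Abs_fps (\<lambda>j. if j = 0 then 0 else c j / of_nat j)"
  proof (rule fps_ext)
    fix n
    have "fps_nth (\<Sum>j=1..N. fps_const (c j / of_nat j) * fps_X ^ j) n
       = (\<Sum>j=1..N. if j = n then c j / of_nat j else 0)"
      by (simp add: fps_sum_nth if_distrib cong: if_cong)
    also have "\<dots> = (if n = 0 then 0 else c n / of_nat n)"
      using c[of n] by (auto simp: sum.delta)
    finally show "fps_nth (\<Sum>j=1..N. fps_const (c j / of_nat j) * fps_X ^ j) n
      = fps_nth (Abs_fps (\<lambda>j. if j = 0 then 0 else c j / of_nat j)) n" by simp
  qed
  finally have "(exp \<circ> ?g) has_fps_expansion exp_series c"
    unfolding exp_series_def by (intro has_fps_expansion_compose has_fps_expansion_exp1) simp_all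
  moreover have hol: "(exp \<circ> ?g) holomorphic_on eball 0 \<infinity>"
    unfolding comp_def by (intro holomorphic_intros)
  ultimately have sums: "(\<lambda>n. fps_nth (exp_series c) n * z ^ n) sums (exp \<circ> ?g) z" for z
    by (rule has_fps_expansion_imp_sums_complex) simp
  show "fps_nth (exp_series c) sums exp (\<Sum>j=1..N. c j / of_nat j)"
    using sums[of 1] by simp
  \<comment> \<open>Convergence at 3 gives absolute convergence at 2, and \<open>2 ^ k\<close>
    dominates \<open>k + 1\<close>.\<close>
  have s: "summable (\<lambda>k. norm (fps_nth (exp_series c) k * 2 ^ k))"
    using sums[of 3] by (intro powser_insidea[of _ 3]) (auto simp: sums_iff)
  show "summable (\<lambda>k. cmod (fps_nth (exp_series c) k) * real (k + 1))"
  proof (rule summable_comparison_test[OF _ s], intro exI allI impI)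
    fix k :: nat
    have "real (k + 1) \<le> 2 ^ k"
      using less_exp[of k] by (metis Suc_eq_plus1 Suc_leI of_nat_le_iff of_nat_numeral of_nat_power)
    thus "norm (cmod (fps_nth (exp_series c) k) * real (k + 1)) \<le> norm (fps_nth (exp_series c) k * 2 ^ k)"
      by (simp add: norm_mult norm_power mult_left_mono)
  qed
qed

subsection \<open>Convolution bounds\<close>

text \<open>Passes from one exponent \<gamma> to every smaller \<alpha> in the unit interval and
  inserts the cutoff at \<open>N\<close>. For \<open>k \<le> 2 * N\<close> the cutoff costs a factor
  2; for larger \<open>k\<close> all relevant \<open>k - j\<close> are at least
  \<open>k / 2\<close>, and only the total mass of \<open>c\<close> matters.\<close>

lemma convolution_bound:
  fixes c :: "nat \<Rightarrow> complex"
  assumes H: "\<And>k. 1 \<le> k \<Longrightarrow>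
      (\<Sum>j=1..k. cmod (c j) * real (k - j + 1) powr (- \<gamma>)) \<le> \<eta> * real k powr (1 - \<gamma>)"
    and c: "\<And>j. N < j \<Longrightarrow> c j = 0" and N: "1 \<le> N" and \<alpha>: "0 \<le> \<alpha>" "\<alpha> \<le> \<gamma>" "\<alpha> \<le> 1" and \<eta>: "0 \<le> \<eta>"
    and k: "1 \<le> k"
  shows "(\<Sum>j=1..k. cmod (c j) * real (k - j + 1) powr (- \<alpha>))
    \<le> 2 * \<eta> * min (real k) (real N) * real k powr (- \<alpha>)"
proof -
  \<comment> \<open>Lowering the exponent costs \<open>(k - j + 1) powr (\<gamma> - a)\<close>, at
    most \<open>k powr (\<gamma> - a)\<close>.\<close>
  have *: "(\<Sum>j=1..k. cmod (c j) * real (k - j + 1) powr (- a)) \<le> \<eta> * real k * real k powr (- a)"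
    if a: "0 \<le> a" "a \<le> \<gamma>" and k: "1 \<le> k" for a k
  proof -
    have "(\<Sum>j=1..k. cmod (c j) * real (k - j + 1) powr (- a))
       \<le> (\<Sum>j=1..k. cmod (c j) * (real (k - j + 1) powr (- \<gamma>) * real k powr (\<gamma> - a)))"
    proof (intro sum_mono mult_left_mono)
      fix j assume j: "j \<in> {1..k}"
      have "real (k - j + 1) powr (- a) = real (k - j + 1) powr (- \<gamma>) * real (k - j + 1) powr (\<gamma> - a)"
        by (simp add: powr_add[symmetric])
      also have "\<dots> \<le> real (k - j + 1) powr (- \<gamma>) * real k powr (\<gamma> - a)"
        using a j by (intro mult_left_mono powr_mono2) auto
      finally show "real (k - j + 1) powr (- a) \<le> real (k - j + 1) powr (- \<gamma>) * real k powr (\<gamma> - a)" .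
    qed auto
    also have "\<dots> = real k powr (\<gamma> - a) * (\<Sum>j=1..k. cmod (c j) * real (k - j + 1) powr (- \<gamma>))"
      by (simp add: sum_distrib_left mult_ac)
    also have "\<dots> \<le> real k powr (\<gamma> - a) * (\<eta> * real k powr (1 - \<gamma>))"
      using k by (intro mult_left_mono H) auto
    also have "\<dots> = \<eta> * (real k powr (\<gamma> - a) * real k powr (1 - \<gamma>))" by simp
    also have "real k powr (\<gamma> - a) * real k powr (1 - \<gamma>) = real k * real k powr (- a)"
      using k by (simp add: powr_add[symmetric] powr_mult_base)
    finally show ?thesis by simp
  qed
  show ?thesis
  proof (cases "k \<le> 2 * N")
    case True
    have "real k \<le> 2 * min (real k) (real N)" using True by auto
    hence "\<eta> * real k * real k powr (- \<alpha>) \<le> \<eta> * (2 * min (real k) (real N)) * real k powr (- \<alpha>)"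
      using \<eta> by (intro mult_right_mono mult_left_mono) auto
    thus ?thesis using *[of \<alpha> k] \<alpha> k by simp
  next
    case False
    have "(\<Sum>j=1..k. cmod (c j) * real (k - j + 1) powr (- \<alpha>))
      = (\<Sum>j=1..N. cmod (c j) * real (k - j + 1) powr (- \<alpha>))"
      using False c by (intro sum.mono_neutral_right) auto
    also have "\<dots> \<le> (\<Sum>j=1..N. cmod (c j) * (2 * real k powr (- \<alpha>)))"
    proof (intro sum_mono mult_left_mono)
      fix j assume j: "j \<in> {1..N}"
      have "real k powr \<alpha> \<le> (2 * real (k - j + 1)) powr \<alpha>"
        using \<alpha> j False by (intro powr_mono2) auto
      also have "\<dots> = 2 powr \<alpha> * real (k - j + 1) powr \<alpha>" by (rule powr_mult)
      also have "\<dots> \<le> 2 * real (k - j + 1) powr \<alpha>"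
        using \<alpha> powr_mono[of \<alpha> 1 "2::real"] by (intro mult_right_mono) auto
      finally show "real (k - j + 1) powr (- \<alpha>) \<le> 2 * real k powr (- \<alpha>)"
        using k by (simp add: powr_minus field_simps)
    qed auto
    \<comment> \<open>The trivial power with exponent 0 presents the mass of \<open>c\<close> as the
      previous bound with \<open>a = 0\<close> and \<open>k = N\<close>.\<close>
    also have "\<dots> = 2 * real k powr (- \<alpha>) * (\<Sum>j=1..N. cmod (c j) * real (N - j + 1) powr (- 0))"
      by (simp add: sum_distrib_left mult_ac)
    also have "\<dots> \<le> 2 * real k powr (- \<alpha>) * (\<eta> * real N * real N powr (- 0))"
      using \<alpha> N by (intro mult_left_mono *) auto
    also have "\<dots> = 2 * \<eta> * min (real k) (real N) * real k powr (- \<alpha>)"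
      using N False by simp
    finally show ?thesis .
  qed
qed

lemma convolution_bound_Linf:
  assumes "0 \<le> \<gamma>" "\<gamma> < 1" and c: "\<And>j. 1 \<le> j \<Longrightarrow> cmod (c j) \<le> r"
  shows "(\<Sum>j=1..k. cmod (c j) * real (k - j + 1) powr (- \<gamma>)) \<le> 1 / (1 - \<gamma>) * r * real k powr (1 - \<gamma>)"
proof -
  have r: "0 \<le> r" using order_trans[OF norm_ge_zero c[of 1]] by simp
  have "(\<Sum>j=1..k. cmod (c j) * real (k - j + 1) powr (- \<gamma>)) \<le> (\<Sum>j=1..k. r * real (k - j + 1) powr (- \<gamma>))"
    using c by (intro sum_mono mult_right_mono) auto
  also have "\<dots> = r * (\<Sum>j=1..k. real (k - j + 1) powr (- \<gamma>))"
    by (rule sum_distrib_left[symmetric])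
  also have "(\<Sum>j=1..k. real (k - j + 1) powr (- \<gamma>)) = (\<Sum>i=1..k. real i powr (- \<gamma>))"
    by (rule sum.reindex_bij_witness[of _ "\<lambda>i. k + 1 - i" "\<lambda>j. k - j + 1"]) auto
  also have "r * \<dots> \<le> r * (real k powr (1 - \<gamma>) / (1 - \<gamma>))"
    using sum_powr_le[OF assms(1,2)] r by (intro mult_left_mono) auto
  finally show ?thesis by simp
qed

text \<open>Hoelder's inequality with conjugate exponent \<open>1 / (1 - 1 / p)\<close>. The dual
  sum of \<open>i powr (- s)\<close> stays of order \<open>k powr (1 - s)\<close> because the
  condition on \<gamma> gives \<open>s < 1\<close>.\<close>

lemma convolution_bound_Lp:
  fixes p \<gamma> r :: real
  assumes "1 < p" "0 \<le> \<gamma>" "\<gamma> < 1 - 1 / p" "0 \<le> r"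
    and c: "\<And>j. N < j \<Longrightarrow> c j = 0" "(\<Sum>j=1..N. cmod (c j) powr p / real j) \<le> r powr p"
    and k: "1 \<le> k"
  shows "(\<Sum>j=1..k. cmod (c j) * real (k - j + 1) powr (- \<gamma>))
    \<le> (1 + 1 / (1 - \<gamma> / (1 - 1 / p))) * r * real k powr (1 - \<gamma>)"
proof (cases "r = 0")
  case True
  \<comment> \<open>Treated apart because the normalisation below divides by
    \<open>r\<close>.\<close>
  have "c j = 0" if "1 \<le> j" for j
  proof (cases "j \<le> N")
    case j: True
    have "cmod (c j) powr p / real j \<le> (\<Sum>j=1..N. cmod (c j) powr p / real j)"
      using that j by (intro member_le_sum) auto
    hence "cmod (c j) powr p / real j \<le> 0" using c(2) True by simp
    moreover have "0 \<le> cmod (c j) powr p / real j" by simp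
    ultimately have "cmod (c j) powr p / real j = 0" by linarith
    thus ?thesis using that by simp
  qed (use c in auto)
  thus ?thesis using True by simp
next
  case False
  hence r: "0 < r" using assms by simp
  define q where "q = 1 / (1 - 1 / p)"
  define s where "s = \<gamma> * q"
  have p0: "0 < 1 - 1 / p" using assms by simp
  have q: "1 < q" "1 / p + 1 / q = 1" using assms p0 by (auto simp: q_def field_simps)
  have s: "0 \<le> s" "s < 1" using assms p0 q by (auto simp: s_def q_def field_simps)
  \<comment> \<open>Normalised for Young's inequality: the \<open>p\<close>-th powers of
    \<open>x\<close> sum to at most 1 and the \<open>q\<close>-th powers of \<open>y\<close> to at
    most \<open>1 / (1 - s)\<close>.\<close>
  define x where "x j = cmod (c j) / (r * real j powr (1 / p))" for j
  define y where "y j = real k powr (\<gamma> - 1 / q) * real (k - j + 1) powr (- \<gamma>)" for j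
  have "(\<Sum>j=1..k. cmod (c j) * real (k - j + 1) powr (- \<gamma>))
     \<le> (\<Sum>j=1..k. r * real k powr (1 - \<gamma>) * (x j powr p + y j powr q))"
  proof (intro sum_mono)
    fix j assume j: "j \<in> {1..k}"
    have "cmod (c j) * real (k - j + 1) powr (- \<gamma>) = real j powr (1 / p) * (r * x j * real (k - j + 1) powr (- \<gamma>))"
      using j r by (simp add: x_def)
    \<comment> \<open>The power of \<open>j\<close> that offsets the harmonic weight
      \<open>1 / j\<close> is at most that of \<open>k\<close>.\<close>
    also have "\<dots> \<le> real k powr (1 / p) * (r * x j * real (k - j + 1) powr (- \<gamma>))"
      using assms j by (intro mult_right_mono powr_mono2) (auto simp: x_def)
    also have "real k powr (1 / p) = real k powr (1 - \<gamma>) * real k powr (\<gamma> - 1 / q)"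
    proof -
      have "1 / p = 1 - \<gamma> + (\<gamma> - 1 / q)" using q(2) by simp
      thus ?thesis by (simp only: powr_add)
    qed
    also have "\<dots> * (r * x j * real (k - j + 1) powr (- \<gamma>)) = r * real k powr (1 - \<gamma>) * (x j * y j)"
      by (simp add: y_def)
    also have "x j * y j \<le> x j powr p / p + y j powr q / q"
      using assms q r by (intro Youngs_inequality) (auto simp: x_def y_def)
    also have "\<dots> \<le> x j powr p + y j powr q"
      using assms q by (intro add_mono) (auto simp: divide_le_eq mult_le_cancel_left1)
    finally show "cmod (c j) * real (k - j + 1) powr (- \<gamma>) \<le> r * real k powr (1 - \<gamma>) * (x j powr p + y j powr q)"
      using r by (simp add: mult_left_mono)
  qed
  also have "\<dots> = r * real k powr (1 - \<gamma>) * ((\<Sum>j=1..k. x j powr p) + (\<Sum>j=1..k. y j powr q))"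
    by (simp add: sum_distrib_left sum.distrib distrib_left)
  also have "\<dots> \<le> r * real k powr (1 - \<gamma>) * (1 + 1 / (1 - s))"
  proof (intro mult_left_mono add_mono)
    have "(\<Sum>j=1..k. x j powr p) = (\<Sum>j=1..k. (cmod (c j) powr p / real j) / r powr p)"
      using assms r by (intro sum.cong) (auto simp: x_def powr_divide powr_mult powr_powr)
    also have "\<dots> \<le> (\<Sum>j=1..max k N. (cmod (c j) powr p / real j) / r powr p)"
      by (intro sum_mono2) auto
    also have "\<dots> = (\<Sum>j=1..N. (cmod (c j) powr p / real j) / r powr p)"
      using c(1) assms by (intro sum.mono_neutral_right) auto
    also have "\<dots> = (\<Sum>j=1..N. cmod (c j) powr p / real j) / r powr p"
      by (rule sum_divide_distrib[symmetric])
    also have "\<dots> \<le> 1" using c(2) r by (simp add: divide_le_eq)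
    finally show "(\<Sum>j=1..k. x j powr p) \<le> 1" .
    have "(\<Sum>j=1..k. y j powr q) = (\<Sum>j=1..k. real k powr (s - 1) * real (k - j + 1) powr (- s))"
      using q by (intro sum.cong) (auto simp: y_def powr_mult powr_powr s_def left_diff_distrib)
    also have "\<dots> = real k powr (s - 1) * (\<Sum>j=1..k. real (k - j + 1) powr (- s))"
      by (rule sum_distrib_left[symmetric])
    also have "(\<Sum>j=1..k. real (k - j + 1) powr (- s)) = (\<Sum>i=1..k. real i powr (- s))"
      by (rule sum.reindex_bij_witness[of _ "\<lambda>i. k + 1 - i" "\<lambda>j. k - j + 1"]) auto
    also have "real k powr (s - 1) * \<dots> \<le> real k powr (s - 1) * (real k powr (1 - s) / (1 - s))"
      using sum_powr_le[OF s] by (intro mult_left_mono) auto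
    also have "\<dots> = 1 / (1 - s)"
      using k by (simp add: powr_add[symmetric])
    finally show "(\<Sum>j=1..k. y j powr q) \<le> 1 / (1 - s)" .
  qed (use r in auto)
  finally show ?thesis by (simp add: s_def q_def mult_ac)
qed

subsection \<open>The centered exponential and the error term\<close>

lemma fps_nth_sums_diff:
  fixes F G :: "'a::real_normed_algebra_1 fps"
  assumes "fps_nth F sums a" "fps_nth G sums b"
  shows "fps_nth (F - G) sums (a - b)"
proof -
  have "fps_nth (F - G) = (\<lambda>n. fps_nth F n - fps_nth G n)" by (rule ext) simp
  thus ?thesis using sums_diff[OF assms] by simp
qed

definition centered_log :: "(nat \<Rightarrow> complex) \<Rightarrow> nat \<Rightarrow> complex fps" where
  "centered_log c N = Abs_fps (\<lambda>j. if j = 0 then 0 else c j / of_nat j)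
     - fps_const (\<Sum>j=1..N. c j / of_nat j)"

text \<open>This is exp(D). It is written as a scaled \<open>exp_series\<close> because D has a
  nonzero constant term in general, so formal composition with D would not give it.\<close>

definition centered_exp :: "(nat \<Rightarrow> complex) \<Rightarrow> nat \<Rightarrow> complex fps" where
  "centered_exp c N = fps_const (exp (- (\<Sum>j=1..N. c j / of_nat j))) * exp_series c"

lemma centered_log_deriv: "fps_X * fps_deriv (centered_log c N) = 1 * log_deriv c"
  by (rule fps_ext) (simp only: fps_X_deriv_nth, simp add: centered_log_def)

lemma centered_exp_deriv: "fps_X * fps_deriv (centered_exp c N) = centered_exp c N * log_deriv c"
  using exp_series_deriv[of c] by (simp add: centered_exp_def mult_ac)

lemma centered_exp_minus_one_deriv:
  "fps_X * fps_deriv (centered_exp c N - 1) = centered_exp c N * log_deriv c"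
  using centered_exp_deriv[of c N] by simp

text \<open>The derivative of exp - 1 - id is exp - 1, so the previous function is the source of
  this one and its gain of \<eta> is inherited.\<close>

lemma centered_exp_remainder_deriv:
  "fps_X * fps_deriv (centered_exp c N - 1 - centered_log c N) = (centered_exp c N - 1) * log_deriv c"
  using centered_exp_deriv[of c N] centered_log_deriv[of c N] by (simp add: algebra_simps)

lemma centered_sums:
  assumes c: "\<And>j. N < j \<Longrightarrow> c j = 0"
  shows "fps_nth (centered_exp c N) sums 1" "fps_nth (centered_log c N) sums 0"
    and "summable (\<lambda>k. cmod (fps_nth (centered_exp c N) k) * real (k + 1))"
    and "summable (\<lambda>k. cmod (fps_nth (centered_log c N) k))"
proof -
  define L where "L = (\<Sum>j=1..N. c j / of_nat j)"
  have eq: "fps_nth (centered_exp c N) = (\<lambda>n. exp (- L) * fps_nth (exp_series c) n)"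
    by (rule ext) (simp only: centered_exp_def L_def[symmetric] fps_mult_left_const_nth)
  show "fps_nth (centered_exp c N) sums 1"
    using sums_mult[OF exp_series_entire(1)[of N c, OF c, folded L_def], of "exp (- L)"]
    unfolding eq by (simp add: mult_exp_exp)
  show "summable (\<lambda>k. cmod (fps_nth (centered_exp c N) k) * real (k + 1))"
    using summable_mult[OF exp_series_entire(2)[of N c, OF c], of "cmod (exp (- L))"]
    by (simp only: eq norm_mult mult.assoc)
  have z: "fps_nth (centered_log c N) k = 0" if "k \<notin> {0..N}" for k
    using that c by (simp add: centered_log_def)
  have "(\<Sum>k=0..N. fps_nth (centered_log c N) k) = 0"
    by (simp add: sum.atLeast_Suc_atMost centered_log_def)
  thus "fps_nth (centered_log c N) sums 0"
    using sums_finite[of "{0..N}" "fps_nth (centered_log c N)"] z by simp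
  show "summable (\<lambda>k. cmod (fps_nth (centered_log c N) k))"
    by (rule summable_finite[of "{0..N}"]) (use z in auto)
qed

section \<open>The iteration over exp, exp - 1 and exp - 1 - id\<close>

lemma binom_mult_bound:
  fixes c :: "nat \<Rightarrow> complex" and \<theta> \<epsilon> \<eta> A :: real
  assumes "0 < \<theta>" "\<theta> \<le> 1" "0 < \<epsilon>" "\<epsilon> \<le> \<theta>" "1 \<le> N" "0 \<le> A" "0 \<le> \<eta>"
    and H: "\<And>k. 1 \<le> k \<Longrightarrow> (\<Sum>j=1..k. cmod (c j) * real (k - j + 1) powr (- (1 - \<theta> + \<epsilon>)))
        \<le> \<eta> * real k powr (1 - (1 - \<theta> + \<epsilon>))"
    and c: "\<And>j. N < j \<Longrightarrow> c j = 0"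
    and Q: "fps_X * fps_deriv Q = W * log_deriv c" "summable (\<lambda>k. cmod (fps_nth Q k))" "fps_nth Q sums l"
    and W: "\<And>i. cmod (fps_nth (binom_series \<theta> * W) i) \<le> A * (real (i + 1) powr (\<theta> - 1)
      + real N powr \<epsilon> * real (i + 1) powr (\<theta> - 1 - \<epsilon>))"
  shows "cmod (fps_nth (binom_series \<theta> * Q) n) \<le> (4 * (\<theta> powr (- \<theta>) * (4 / \<epsilon>) + 2)) *
     (cmod l * real (n + 1) powr (\<theta> - 1)
      + 2 * \<eta> * A * (real N powr \<epsilon> * real (n + 1) powr (\<theta> - 1 - \<epsilon>)))"
proof -
  \<comment> \<open>The doubled \<eta> absorbs the factor 2 of
    \<open>convolution_bound\<close>.\<close>
  interpret weighted_recurrence \<theta> \<epsilon> "2 * \<eta>" A N c "fps_nth (binom_series \<theta> * W)"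
    "fps_nth (binom_series \<theta> * Q)" l
  proof
    fix n :: nat
    show "of_nat n * fps_nth (binom_series \<theta> * Q) n
      = of_real \<theta> * (\<Sum>k<n. fps_nth (binom_series \<theta> * Q) k)
        + (\<Sum>j=1..n. c j * fps_nth (binom_series \<theta> * W) (n - j))"
      by (rule binom_series_mult_rec[OF Q(1)])
  next
    show "(\<lambda>n. (\<Sum>k\<le>n. fps_nth (binom_series \<theta> * Q) k) / of_real (rise \<theta> n)) \<longlonglongrightarrow> l"
      using assms by (intro sum_binom_mult_tendsto) auto
  next
    fix k :: nat and \<alpha> :: real
    assume "1 \<le> k" "\<alpha> \<in> {1 - \<theta>, 1 - \<theta> + \<epsilon>}"
    thus "(\<Sum>j=1..k. cmod (c j) * real (k - j + 1) powr (- \<alpha>))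
        \<le> 2 * \<eta> * min (real k) (real N) * real k powr (- \<alpha>)"
      using assms(1-7) by (intro convolution_bound[OF H c]) auto
  qed (use assms in auto)
  have "real (n + 1) powr (\<theta> - 1) * real (n + 1) powr (- \<epsilon>) = real (n + 1) powr (\<theta> - 1 - \<epsilon>)"
    by (simp add: powr_add[symmetric])
  hence eq: "real (n + 1) powr (\<theta> - 1) * (cmod l + 2 * \<eta> * A * real N powr \<epsilon> * real (n + 1) powr (- \<epsilon>))
    = cmod l * real (n + 1) powr (\<theta> - 1)
      + 2 * \<eta> * A * (real N powr \<epsilon> * real (n + 1) powr (\<theta> - 1 - \<epsilon>))"
    by (simp add: algebra_simps)
  show ?thesis using V_bound[of n] unfolding eq mult.assoc[of _ "real (n + 1) powr (\<theta> - 1)"] .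
qed

text \<open>Three applications of \<open>binom_mult_bound\<close>. The first has
  \<open>U = V\<close> and closes by absorption; the other two have limit 0 and gain a factor \<eta>
  each.\<close>

lemma binom_remainder_bound:
  fixes \<theta> \<epsilon> :: real
  assumes \<theta>: "0 < \<theta>" "\<theta> \<le> 1" and \<epsilon>: "0 < \<epsilon>" "\<epsilon> \<le> \<theta>"
  obtains \<delta> K :: real where "0 < \<delta>" "0 < K"
    "\<And>(c :: nat \<Rightarrow> complex) N \<eta> n. 1 \<le> N \<Longrightarrow> 0 \<le> \<eta> \<Longrightarrow> \<eta> \<le> \<delta> \<Longrightarrow> (\<And>j. N < j \<Longrightarrow> c j = 0) \<Longrightarrow>
      (\<And>k. 1 \<le> k \<Longrightarrow> (\<Sum>j=1..k. cmod (c j) * real (k - j + 1) powr (- (1 - \<theta> + \<epsilon>)))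
        \<le> \<eta> * real k powr (1 - (1 - \<theta> + \<epsilon>))) \<Longrightarrow>
      cmod (fps_nth (binom_series \<theta> * (centered_exp c N - 1 - centered_log c N)) n)
        \<le> K * \<eta>\<^sup>2 * (real N powr \<epsilon> * real (n + 1) powr (\<theta> - 1 - \<epsilon>))"
proof -
  define K where "K = 4 * (\<theta> powr (- \<theta>) * (4 / \<epsilon>) + 2)"
  have K: "0 < K" using \<epsilon> \<theta> by (simp add: K_def add_nonneg_pos)
  show ?thesis
  \<comment> \<open>The threshold gives \<open>2 * K * \<eta> \<le> 1 / 2\<close>, so half of the
    supremum is absorbed. The successive constants are \<open>2 * K\<close>, then
    \<open>4 * K\<^sup>2 * \<eta>\<close>, then \<open>8 * K ^ 3 * \<eta>\<^sup>2\<close>.\<close>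
  proof (rule that[of "1 / (4 * K)" "8 * K ^ 3"])
    fix c :: "nat \<Rightarrow> complex" and N n :: nat and \<eta> :: real
    assume N: "1 \<le> N" and \<eta>: "0 \<le> \<eta>" "\<eta> \<le> 1 / (4 * K)" and c: "\<And>j. N < j \<Longrightarrow> c j = 0"
      and H: "\<And>k. 1 \<le> k \<Longrightarrow> (\<Sum>j=1..k. cmod (c j) * real (k - j + 1) powr (- (1 - \<theta> + \<epsilon>)))
        \<le> \<eta> * real k powr (1 - (1 - \<theta> + \<epsilon>))"
    define a where "a n = real (n + 1) powr (\<theta> - 1)" for n
    define b where "b n = real N powr \<epsilon> * real (n + 1) powr (\<theta> - 1 - \<epsilon>)" for n
    have a: "0 < a n" and b: "0 < b n" for n using N by (auto simp: a_def b_def)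
    let ?v = "\<lambda>Q n. cmod (fps_nth (binom_series \<theta> * Q) n)"
    have step: "?v Q n \<le> K * (cmod l * a n + 2 * \<eta> * A * b n)"
      if "0 \<le> A" "fps_X * fps_deriv Q = W * log_deriv c" "summable (\<lambda>k. cmod (fps_nth Q k))"
        "fps_nth Q sums l" "\<And>i. ?v W i \<le> A * (a i + b i)" for Q W l A n
      unfolding K_def a_def b_def
      by (rule binom_mult_bound[OF \<theta> \<epsilon> N that(1) \<eta>(1) H c that(2-4) that(5)[unfolded a_def b_def]])
    note sums = centered_sums[of N c, OF c]
    have summable0: "summable (\<lambda>k. cmod (fps_nth (centered_exp c N) k))"
      by (rule summable_comparison_test[OF _ sums(3)]) (auto simp: mult_le_cancel_left1)
    have sums1: "fps_nth (1 :: complex fps) sums 1"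
      using sums_single[of 0 "\<lambda>_. 1 :: complex"] by (simp add: fps_one_nth[abs_def] eq_commute)
    have summable1: "summable (\<lambda>k. cmod (fps_nth (1 :: complex fps) k))"
      by (rule summable_finite[of "{0}"]) auto

    \<comment> \<open>Absorption is legitimate only for a finite supremum.\<close>
    have bdd: "bdd_above (range (\<lambda>n. ?v (centered_exp c N) n / (a n + b n)))"
    proof -
      obtain A where A: "0 \<le> A" "\<And>n. ?v (centered_exp c N) n \<le> A * a n"
        using binom_mult_bounded[OF \<theta> sums(3)] unfolding a_def by blast
      have "?v (centered_exp c N) n / (a n + b n) \<le> A" for n
      proof -
        have "?v (centered_exp c N) n \<le> A * (a n + b n)"
          using A(2)[of n] mult_nonneg_nonneg[OF A(1), of "b n"] b[of n] by (simp add: distrib_left)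
        thus ?thesis using a[of n] b[of n] by (simp add: pos_divide_le_eq)
      qed
      thus ?thesis by (intro bdd_aboveI2)
    qed
    define A0 where "A0 = (SUP n. ?v (centered_exp c N) n / (a n + b n))"
    have le_A0: "?v (centered_exp c N) n \<le> A0 * (a n + b n)" for n
      using cSUP_upper[OF UNIV_I bdd, of n] a[of n] b[of n]
      unfolding A0_def[symmetric] by (simp add: pos_divide_le_eq)
    have "0 \<le> A0"
      using le_A0[of 0] norm_ge_zero[of "fps_nth (binom_series \<theta> * centered_exp c N) 0"] a[of 0] b[of 0]
      by (smt (verit) mult_neg_pos)
    \<comment> \<open>Since exp is its own derivative, the best constant \<open>A0\<close> is both
      the hypothesis and the quantity estimated.\<close>
    have "A0 \<le> K * (1 + 2 * \<eta> * A0)"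
      unfolding A0_def
    proof (rule cSUP_least)
      fix n
      have "?v (centered_exp c N) n \<le> K * (cmod 1 * a n + 2 * \<eta> * A0 * b n)"
        by (rule step[OF \<open>0 \<le> A0\<close> centered_exp_deriv summable0 sums(1) le_A0])
      also have "\<dots> \<le> K * ((1 + 2 * \<eta> * A0) * (a n + b n))"
        using K \<eta> \<open>0 \<le> A0\<close> a[of n] b[of n] by (intro mult_left_mono) (auto simp: algebra_simps)
      finally show "?v (centered_exp c N) n / (a n + b n)
          \<le> K * (1 + 2 * \<eta> * (SUP n. ?v (centered_exp c N) n / (a n + b n)))"
        using a[of n] b[of n] unfolding A0_def[symmetric] by (simp add: pos_divide_le_eq)
    qed simp
    moreover have "K * (2 * \<eta> * A0) \<le> K * (2 * (1 / (4 * K)) * A0)"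
      using K \<eta> \<open>0 \<le> A0\<close> by (intro mult_left_mono mult_right_mono) auto
    hence "K * (2 * \<eta> * A0) \<le> A0 / 2" using K by simp
    ultimately have "A0 \<le> 2 * K" by (simp add: distrib_left)
    hence v0: "?v (centered_exp c N) n \<le> 2 * K * (a n + b n)" for n
      using le_A0[of n] mult_right_mono[of A0 "2 * K" "a n + b n"] a[of n] b[of n] by linarith
    \<comment> \<open>With limit 0 the \<open>a n\<close> term drops out of the estimate; it is
      added back only to match the profile required of the next source.\<close>
    have v1: "?v (centered_exp c N - 1) n \<le> 4 * K\<^sup>2 * \<eta> * (a n + b n)" for n
    proof -
      have "?v (centered_exp c N - 1) n \<le> K * (cmod 0 * a n + 2 * \<eta> * (2 * K) * b n)"
      proof (rule step[OF _ centered_exp_minus_one_deriv _ _ v0])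
        show "fps_nth (centered_exp c N - 1) sums 0"
          using fps_nth_sums_diff[OF sums(1) sums1] by simp
        show "summable (\<lambda>k. cmod (fps_nth (centered_exp c N - 1) k))"
          by (rule summable_comparison_test[OF _ summable_add[OF summable0 summable1]])
             (auto intro: norm_triangle_ineq4)
      qed (use K in auto)
      also have "\<dots> \<le> 4 * K\<^sup>2 * \<eta> * (a n + b n)"
        using K \<eta> a[of n] by (simp add: power2_eq_square algebra_simps)
      finally show ?thesis .
    qed
    have "?v (centered_exp c N - 1 - centered_log c N) n \<le> K * (cmod 0 * a n + 2 * \<eta> * (4 * K\<^sup>2 * \<eta>) * b n)"
    proof (rule step[OF _ centered_exp_remainder_deriv _ _ v1])
      show "fps_nth (centered_exp c N - 1 - centered_log c N) sums 0"
        using fps_nth_sums_diff[OF fps_nth_sums_diff[OF sums(1) sums1] sums(2)] by simp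
      show "summable (\<lambda>k. cmod (fps_nth (centered_exp c N - 1 - centered_log c N) k))"
        by (rule summable_comparison_test[OF _ summable_add[OF summable_add[OF summable0 summable1] sums(4)]])
           (auto intro!: order_trans[OF norm_triangle_ineq4] add_right_mono)
    qed (use K \<eta> in auto)
    thus "?v (centered_exp c N - 1 - centered_log c N) n
        \<le> 8 * K ^ 3 * \<eta>\<^sup>2 * (real N powr \<epsilon> * real (n + 1) powr (\<theta> - 1 - \<epsilon>))"
      by (simp add: b_def power2_eq_square power3_eq_cube mult_ac)
  qed (use K in auto)
qed

section \<open>Comparison with the coefficients of the full product\<close>

text \<open>Convolving the error profile with the nonnegative factor costs only a constant relative
  to the product coefficient. Both sides are compared with \<open>T * N powr (\<theta> - 1)\<close>,
  where \<open>T\<close> is the mass of that factor up to \<open>N\<close>.\<close>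

lemma binom_series_comparison:
  fixes e :: "nat \<Rightarrow> real" and \<theta> \<epsilon> D :: real
  assumes \<theta>: "0 < \<theta>" "\<theta> \<le> 1" and \<epsilon>: "0 < \<epsilon>" "\<epsilon> < \<theta>"
    and e: "\<And>j. 1 \<le> j \<Longrightarrow> 0 \<le> e j \<and> e j \<le> D" and N: "1 \<le> N"
  shows "(\<Sum>k\<le>N. fps_nth (exp_series e) (N - k) * (real N powr \<epsilon> * real (k + 1) powr (\<theta> - 1 - \<epsilon>)))
    \<le> (4 * D / (\<theta> - \<epsilon>) + 2) * (2 / \<theta>) * fps_nth (exp_series e * binom_series \<theta>) N"
proof -
  define B where "B = fps_nth (exp_series e)"
  define T where "T = (\<Sum>k\<le>N. B k)"
  have B: "0 \<le> B k" for k
    unfolding B_def using e by (intro exp_series_nonneg) auto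
  have T: "0 \<le> T" using B by (simp add: T_def sum_nonneg)
  have T': "T = (\<Sum>k\<le>N. B (N - k))"
    unfolding T_def by (rule sum.reindex_bij_witness[of _ "\<lambda>k. N - k" "\<lambda>k. N - k"]) auto
  have D: "0 \<le> D" using e[of 1] by simp
  let ?w = "\<lambda>k. real N powr \<epsilon> * real (k + 1) powr (\<theta> - 1 - \<epsilon>)"
  \<comment> \<open>Split at \<open>k = N / 2\<close>. On \<open>?I\<close> the index
    \<open>N - k\<close> is large and \<open>exp_series_le_sum\<close> makes the coefficient small;
    on \<open>?J\<close> the profile itself is at most
    \<open>2 * N powr (\<theta> - 1)\<close>.\<close>
  let ?I = "{..N} \<inter> {k. 2 * k \<le> N}" and ?J = "{..N} \<inter> - {k. 2 * k \<le> N}"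
  have "(\<Sum>k\<in>?I. B (N - k) * ?w k) \<le> (\<Sum>k\<in>?I. 2 * D * T / real N * ?w k)"
  proof (intro sum_mono mult_right_mono)
    fix k assume k: "k \<in> ?I"
    have "real N * B (N - k) \<le> 2 * real (N - k) * B (N - k)"
      using k B by (intro mult_right_mono) auto
    also have "\<dots> = 2 * (real (N - k) * B (N - k))" by (rule mult.assoc)
    also have "real (N - k) * B (N - k) \<le> D * T"
      unfolding B_def T_def by (rule exp_series_le_sum) (use e k N in auto)
    finally show "B (N - k) \<le> 2 * D * T / real N" using N by (simp add: field_simps)
  qed auto
  also have "\<dots> = 2 * D * T / real N * real N powr \<epsilon> * (\<Sum>k\<in>?I. real (k + 1) powr (\<theta> - 1 - \<epsilon>))"
    by (simp add: sum_distrib_left mult_ac)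
  \<comment> \<open>As \<open>\<epsilon> < \<theta>\<close>, the exponent exceeds -1 and the power
    sum is of order \<open>N powr (\<theta> - \<epsilon>)\<close>.\<close>
  also have "\<dots> \<le> 2 * D * T / real N * real N powr \<epsilon> * (2 * real N powr (\<theta> - \<epsilon>) / (\<theta> - \<epsilon>))"
  proof (intro mult_left_mono)
    have "(\<Sum>k\<in>?I. real (k + 1) powr (\<theta> - 1 - \<epsilon>)) \<le> (\<Sum>k\<le>N. real (k + 1) powr (\<theta> - 1 - \<epsilon>))"
      by (intro sum_mono2) auto
    also have "\<dots> = (\<Sum>i=1..N+1. real i powr (- (1 - \<theta> + \<epsilon>)))"
      by (rule sum.reindex_bij_witness[of _ "\<lambda>i. i - 1" "\<lambda>k. k + 1"]) (auto simp: algebra_simps)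
    also have "\<dots> \<le> real (N + 1) powr (1 - (1 - \<theta> + \<epsilon>)) / (1 - (1 - \<theta> + \<epsilon>))"
      using \<theta> \<epsilon> by (intro sum_powr_le) auto
    also have "\<dots> = real (N + 1) powr (\<theta> - \<epsilon>) / (\<theta> - \<epsilon>)" by simp
    also have "real (N + 1) powr (\<theta> - \<epsilon>) \<le> (2 * real N) powr (\<theta> - \<epsilon>)"
      using \<epsilon> N by (intro powr_mono2) auto
    also have "\<dots> = 2 powr (\<theta> - \<epsilon>) * real N powr (\<theta> - \<epsilon>)" by (rule powr_mult)
    also have "\<dots> \<le> 2 * real N powr (\<theta> - \<epsilon>)"
      using powr_mono[of "\<theta> - \<epsilon>" 1 "2::real"] \<theta> \<epsilon> by (intro mult_right_mono) auto
    finally show "(\<Sum>k\<in>?I. real (k + 1) powr (\<theta> - 1 - \<epsilon>)) \<le> 2 * real N powr (\<theta> - \<epsilon>) / (\<theta> - \<epsilon>)"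
      using \<epsilon> by (simp add: divide_right_mono)
  qed (use D T in auto)
  also have "\<dots> = 4 * D / (\<theta> - \<epsilon>) * (T * (real N powr \<epsilon> * real N powr (\<theta> - \<epsilon>) / real N))"
    by (simp add: mult_ac)
  also have "real N powr \<epsilon> * real N powr (\<theta> - \<epsilon>) / real N = real N powr (\<theta> - 1)"
    unfolding powr_add[symmetric] using N by (simp add: powr_diff)
  finally have I: "(\<Sum>k\<in>?I. B (N - k) * ?w k) \<le> 4 * D / (\<theta> - \<epsilon>) * (T * real N powr (\<theta> - 1))" .

  have "(\<Sum>k\<in>?J. B (N - k) * ?w k) \<le> (\<Sum>k\<in>?J. B (N - k) * (2 * real N powr (\<theta> - 1)))"
  proof (intro sum_mono mult_left_mono B)
    fix k assume k: "k \<in> ?J"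
    have "real N powr (1 - \<theta> + \<epsilon>) \<le> (2 * real (k + 1)) powr (1 - \<theta> + \<epsilon>)"
      using k \<theta> \<epsilon> by (intro powr_mono2) auto
    also have "\<dots> = 2 powr (1 - \<theta> + \<epsilon>) * real (k + 1) powr (1 - \<theta> + \<epsilon>)" by (rule powr_mult)
    also have "\<dots> \<le> 2 * real (k + 1) powr (1 - \<theta> + \<epsilon>)"
      using powr_mono[of "1 - \<theta> + \<epsilon>" 1 "2::real"] \<theta> \<epsilon> by (intro mult_right_mono) auto
    finally have le: "real N powr (1 - \<theta> + \<epsilon>) \<le> 2 * real (k + 1) powr (1 - \<theta> + \<epsilon>)" .
    have eq: "real m powr (\<theta> - 1 - \<epsilon>) = 1 / real m powr (1 - \<theta> + \<epsilon>)" for m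
      using powr_minus_divide[of "real m" "1 - \<theta> + \<epsilon>"] by (simp add: algebra_simps)
    have inv: "1 / y \<le> 2 * (1 / x)" if "x \<le> 2 * y" "0 < x" "0 < y" for x y :: real
      using that by (simp add: field_simps)
    have "real (k + 1) powr (\<theta> - 1 - \<epsilon>) \<le> 2 * real N powr (\<theta> - 1 - \<epsilon>)"
      unfolding eq by (rule inv[OF le]) (use N in auto)
    hence "?w k \<le> real N powr \<epsilon> * (2 * real N powr (\<theta> - 1 - \<epsilon>))"
      by (intro mult_left_mono) auto
    also have "\<dots> = 2 * real N powr (\<theta> - 1)"
      by (simp add: powr_add[symmetric])
    finally show "?w k \<le> 2 * real N powr (\<theta> - 1)" .
  qed
  also have "\<dots> = (\<Sum>k\<in>?J. B (N - k)) * (2 * real N powr (\<theta> - 1))"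
    by (rule sum_distrib_right[symmetric])
  also have "\<dots> \<le> T * (2 * real N powr (\<theta> - 1))"
    unfolding T' using B by (intro mult_right_mono sum_mono2) auto
  finally have J: "(\<Sum>k\<in>?J. B (N - k) * ?w k) \<le> 2 * (T * real N powr (\<theta> - 1))" by simp

  \<comment> \<open>Lower bound for the product: each binomial coefficient up to \<open>N\<close> is
    at least \<open>\<theta> * (N + 1) powr (\<theta> - 1)\<close>.\<close>
  have "T * real N powr (\<theta> - 1) = T * real N powr (- (1 - \<theta>))" by simp
  also have "\<dots> \<le> T * (2 * real (N + 1) powr (- (1 - \<theta>)))"
    using \<theta> N T by (intro mult_left_mono powr_nat_le_double) auto
  also have "\<dots> = 2 * (\<Sum>k\<le>N. B (N - k) * real (N + 1) powr (\<theta> - 1))"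
    by (simp add: T' sum_distrib_right sum_distrib_left mult_ac)
  also have "\<dots> \<le> 2 * (\<Sum>k\<le>N. B (N - k) * (fps_nth (binom_series \<theta> :: real fps) k / \<theta>))"
  proof (intro mult_left_mono sum_mono B)
    fix k assume k: "k \<in> {..N}"
    have "real (N + 1) powr (\<theta> - 1) \<le> real (k + 1) powr (\<theta> - 1)"
      using k \<theta> by (intro powr_mono2') auto
    also have "\<dots> \<le> fps_nth (binom_series \<theta> :: real fps) k / \<theta>"
      using binom_series_bounds(1)[OF \<theta>, of k] \<theta> by (simp only: pos_le_divide_eq mult.commute)
    finally show "real (N + 1) powr (\<theta> - 1) \<le> fps_nth (binom_series \<theta> :: real fps) k / \<theta>" .
  qed auto
  also have "\<dots> = 2 / \<theta> * fps_nth (exp_series e * binom_series \<theta>) N"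
  proof -
    have "fps_nth (exp_series e * binom_series \<theta>) N = (\<Sum>k\<le>N. B (N - k) * fps_nth (binom_series \<theta>) k)"
      unfolding mult.commute[of "exp_series e"] fps_mult_nth atLeast0AtMost B_def
      by (intro sum.cong mult.commute refl)
    thus ?thesis by (simp only: sum_distrib_left) (simp add: mult_ac)
  qed
  finally have low: "T * real N powr (\<theta> - 1) \<le> 2 / \<theta> * fps_nth (exp_series e * binom_series \<theta>) N" .

  have "(\<Sum>k\<le>N. B (N - k) * ?w k) = (\<Sum>k\<in>?I. B (N - k) * ?w k) + (\<Sum>k\<in>?J. B (N - k) * ?w k)"
    by (rule sum.Int_Diff[of "{..N}" _ "{k. 2 * k \<le> N}", unfolded Diff_eq]) simp
  also have "\<dots> \<le> (4 * D / (\<theta> - \<epsilon>) + 2) * (T * real N powr (\<theta> - 1))"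
    using I J by (simp add: distrib_right)
  also have "\<dots> \<le> (4 * D / (\<theta> - \<epsilon>) + 2) * (2 / \<theta> * fps_nth (exp_series e * binom_series \<theta>) N)"
    using low D \<epsilon> by (intro mult_left_mono) auto
  finally show ?thesis unfolding B_def by (simp only: mult.assoc)
qed

section \<open>The truncated weights and the norm rho\<close>

text \<open>The cut at \<open>N\<close> leaves the coefficient of z^N unchanged and makes the
  logarithm a polynomial, so that its value at 1 exists.\<close>

definition excess :: "(nat \<Rightarrow> real) \<Rightarrow> (nat \<Rightarrow> complex) \<Rightarrow> nat \<Rightarrow> nat \<Rightarrow> complex" where
  "excess d f N j = (if 1 \<le> j \<and> j \<le> N then of_real (d j) * (f j - 1) else 0)"

lemma excess_convolution_bound:
  fixes \<theta> dp :: real and p :: ereal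
  assumes \<theta>: "0 < \<theta>" "\<theta> \<le> 1" and p: "ereal (1 / \<theta>) < p" and dp: "0 < dp"
  obtains \<epsilon> C where "0 < \<epsilon>" "\<epsilon> < \<theta>" "0 < C"
    "\<And>d f N k. \<lbrakk>\<And>j. 1 \<le> j \<Longrightarrow> 0 \<le> d j \<and> d j \<le> dp; 1 \<le> N; 1 \<le> k\<rbrakk> \<Longrightarrow>
      (\<Sum>j=1..k. cmod (excess d f N j) * real (k - j + 1) powr (- (1 - \<theta> + \<epsilon>)))
        \<le> C * rho f N p * real k powr (1 - (1 - \<theta> + \<epsilon>))"
proof (cases p)
  case (real q)
  have q: "1 / \<theta> < q" using p real by simp
  have "1 \<le> 1 / \<theta>" using \<theta> by simp
  hence q1: "1 < q" using q by linarith
  have tq: "1 / q < \<theta>" using q \<theta> q1 by (simp add: field_simps)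
  \<comment> \<open>Half of the available room: any positive value below
    \<open>\<theta> - 1 / q\<close> keeps \<gamma> under the Hoelder threshold
    \<open>1 - 1 / q\<close>.\<close>
  define \<epsilon> where "\<epsilon> = (\<theta> - 1 / q) / 2"
  define \<gamma> where "\<gamma> = 1 - \<theta> + \<epsilon>"
  have \<epsilon>: "0 < \<epsilon>" "\<epsilon> < \<theta>" using tq \<theta> q1 by (auto simp: \<epsilon>_def field_simps intro: add_pos_pos)
  have "1 - \<theta> + (\<theta> - x) / 2 < 1 - x" if "x < \<theta>" for x :: real
    using that by (simp add: field_simps)
  from this[OF tq] have \<gamma>: "0 \<le> \<gamma>" "\<gamma> < 1 - 1 / q"
    using \<theta> \<epsilon> by (auto simp: \<gamma>_def \<epsilon>_def)
  define C where "C = 1 + 1 / (1 - \<gamma> / (1 - 1 / q))"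
  have q0: "0 < 1 - 1 / q" using q1 by simp
  have C: "0 < C" using \<gamma> q0 by (simp add: C_def add_pos_nonneg)
  show ?thesis
  proof (rule that[OF \<epsilon>, of "C * dp"])
    fix d :: "nat \<Rightarrow> real" and f :: "nat \<Rightarrow> complex" and N k :: nat
    assume d: "\<And>j. 1 \<le> j \<Longrightarrow> 0 \<le> d j \<and> d j \<le> dp" and N: "1 \<le> N" and k: "1 \<le> k"
    define s where "s = (\<Sum>j=1..N. cmod (f j - 1) powr q / real j)"
    have s: "0 \<le> s" by (simp add: s_def sum_nonneg)
    have rho: "rho f N p = s powr (1 / q)" using real by (simp add: rho_def s_def)
    have "(\<Sum>j=1..k. cmod (excess d f N j) * real (k - j + 1) powr (- \<gamma>))
      \<le> C * (dp * rho f N p) * real k powr (1 - \<gamma>)"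
      unfolding C_def
    proof (rule convolution_bound_Lp[OF q1 \<gamma> _ _ _ k])
      show "0 \<le> dp * rho f N p" using dp by (simp add: rho)
      show "excess d f N j = 0" if "N < j" for j using that by (simp add: excess_def)
      have "(\<Sum>j=1..N. cmod (excess d f N j) powr q / real j)
        \<le> (\<Sum>j=1..N. dp powr q * (cmod (f j - 1) powr q / real j))"
      proof (rule sum_mono)
        fix j assume j: "j \<in> {1..N}"
        have "cmod (excess d f N j) \<le> dp * cmod (f j - 1)"
          using d[of j] j by (auto simp: excess_def norm_mult intro: mult_right_mono)
        hence "cmod (excess d f N j) powr q \<le> (dp * cmod (f j - 1)) powr q"
          using q1 by (intro powr_mono2) auto
        also have "\<dots> = dp powr q * cmod (f j - 1) powr q" by (rule powr_mult)
        finally show "cmod (excess d f N j) powr q / real j \<le> dp powr q * (cmod (f j - 1) powr q / real j)"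
          using j by (simp add: divide_right_mono)
      qed
      also have "\<dots> = dp powr q * s" by (simp add: s_def sum_distrib_left)
      also have "\<dots> = (dp * rho f N p) powr q"
        using s q1 by (simp add: rho powr_mult powr_powr)
      finally show "(\<Sum>j=1..N. cmod (excess d f N j) powr q / real j) \<le> (dp * rho f N p) powr q" .
    qed
    thus "(\<Sum>j=1..k. cmod (excess d f N j) * real (k - j + 1) powr (- (1 - \<theta> + \<epsilon>)))
        \<le> C * dp * rho f N p * real k powr (1 - (1 - \<theta> + \<epsilon>))"
      by (simp only: \<gamma>_def mult.assoc)
  qed (use C dp in simp)
next
  case PInf
  define \<gamma> where "\<gamma> = 1 - \<theta> + \<theta> / 2"
  have \<gamma>: "0 \<le> \<gamma>" "\<gamma> < 1" using \<theta> by (auto simp: \<gamma>_def)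
  show ?thesis
  proof (rule that[of "\<theta> / 2" "1 / (1 - \<gamma>) * dp"])
    fix d :: "nat \<Rightarrow> real" and f :: "nat \<Rightarrow> complex" and N k :: nat
    assume d: "\<And>j. 1 \<le> j \<Longrightarrow> 0 \<le> d j \<and> d j \<le> dp" and N: "1 \<le> N" and k: "1 \<le> k"
    have g: "cmod (f j - 1) \<le> rho f N p" if "1 \<le> j" "j \<le> N" for j
      using that PInf by (simp add: rho_def)
    have r: "0 \<le> rho f N p" using order_trans[OF norm_ge_zero g[of 1]] N by simp
    have "(\<Sum>j=1..k. cmod (excess d f N j) * real (k - j + 1) powr (- \<gamma>))
      \<le> 1 / (1 - \<gamma>) * (dp * rho f N p) * real k powr (1 - \<gamma>)"
    proof (rule convolution_bound_Linf[OF \<gamma>])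
      fix j :: nat assume "1 \<le> j"
      thus "cmod (excess d f N j) \<le> dp * rho f N p"
        using d[of j] g[of j] r dp by (auto simp: excess_def norm_mult intro: mult_mono)
    qed
    thus "(\<Sum>j=1..k. cmod (excess d f N j) * real (k - j + 1) powr (- (1 - \<theta> + \<theta> / 2)))
        \<le> 1 / (1 - \<gamma>) * dp * rho f N p * real k powr (1 - (1 - \<theta> + \<theta> / 2))"
      by (simp only: \<gamma>_def mult.assoc)
  qed (use \<theta> \<gamma> dp in auto)
qed (use p in auto)

section \<open>Exact expansion and conclusion\<close>

text \<open>An exact identity without any smallness: \<open>exp (L1 d f N)\<close> is pulled out and
  exp(D) is split as 1 + D plus remainder.\<close>

lemma M_coeff_expansion:
  assumes "p_coeff d N \<noteq> 0"
  shows "M_coeff d f N / complex_of_real (p_coeff d N) =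
    exp (L1 d f N) *
      (1 + (\<Sum>j=1..N. complex_of_real (d j) * ((f j - 1) / of_nat j) *
              complex_of_real (p_coeff d (N - j) / p_coeff d N - 1))
         + fps_nth (exp_series (\<lambda>j. of_real (d j)) *
             (centered_exp (excess d f N) N - 1 - centered_log (excess d f N) N)) N
           / complex_of_real (p_coeff d N))"
proof -
  define c where "c = excess d f N"
  define P where "P = exp_series (\<lambda>j. complex_of_real (d j))"
  define R where "R = fps_nth (P * (centered_exp c N - 1 - centered_log c N)) N"
  define pN where "pN = complex_of_real (p_coeff d N)"
  have pN: "pN \<noteq> 0" using assms by (simp add: pN_def)
  have P: "fps_nth P n = complex_of_real (p_coeff d n)" for n
    by (simp add: P_def p_coeff_def exp_series_of_real)
  have L: "(\<Sum>j=1..N. c j / of_nat j) = L1 d f N"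
    unfolding L1_def c_def by (intro sum.cong) (auto simp: excess_def)
  have "M_coeff d f N = fps_nth (exp_series (\<lambda>j. of_real (d j) + c j)) N"
    unfolding M_coeff_def by (rule exp_series_cong) (simp add: c_def excess_def algebra_simps)
  also have "\<dots> = fps_nth (P * exp_series c) N"
    by (simp add: exp_series_add P_def)
  also have "exp_series c = fps_const (exp (L1 d f N)) * centered_exp c N"
    unfolding centered_exp_def L mult.assoc[symmetric] fps_const_mult mult_exp_exp by simp
  also have "P * (fps_const (exp (L1 d f N)) * centered_exp c N)
      = fps_const (exp (L1 d f N)) *
        (P + P * centered_log c N + P * (centered_exp c N - 1 - centered_log c N))"
    by (simp add: algebra_simps)
  finally have M: "M_coeff d f N = exp (L1 d f N) * (pN + fps_nth (P * centered_log c N) N + R)"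
    by (simp add: P R_def pN_def)
  \<comment> \<open>The constant term of D contributes \<open>- pN * L1 d f N\<close>; distributing
    it over \<open>j\<close> produces the differences
    \<open>p_coeff d (N - j) / p_coeff d N - 1\<close>.\<close>
  have "fps_nth (P * centered_log c N) N
      = fps_nth (P * log_deriv (\<lambda>j. c j / of_nat j)) N - pN * L1 d f N"
    unfolding centered_log_def L by (simp add: right_diff_distrib P pN_def)
  also have "\<dots> = (\<Sum>j=1..N. c j / of_nat j * of_real (p_coeff d (N - j))) - (\<Sum>j=1..N. c j / of_nat j * pN)"
    unfolding fps_mult_log_deriv_nth L[symmetric] by (simp add: P sum_distrib_left mult.commute)
  also have "\<dots> = pN * (\<Sum>j=1..N. c j / of_nat j * (of_real (p_coeff d (N - j)) / pN - 1))"
    using pN by (simp add: sum_subtractf[symmetric] sum_distrib_left algebra_simps)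
  also have "(\<Sum>j=1..N. c j / of_nat j * (of_real (p_coeff d (N - j)) / pN - 1))
     = (\<Sum>j=1..N. complex_of_real (d j) * ((f j - 1) / of_nat j) *
              complex_of_real (p_coeff d (N - j) / p_coeff d N - 1))"
    by (intro sum.cong) (auto simp: c_def excess_def pN_def)
  finally have "M_coeff d f N = exp (L1 d f N) * (pN * (1 + (\<Sum>j=1..N. complex_of_real (d j) * ((f j - 1) / of_nat j) *
              complex_of_real (p_coeff d (N - j) / p_coeff d N - 1)) + R / pN))"
    using pN unfolding M by (simp add: distrib_left)
  thus ?thesis
    unfolding R_def P_def c_def pN_def[symmetric] using pN by simp
qed

theorem theorem12:
  fixes dm dp :: real and p :: ereal
  assumes "0 < dm" and "dm \<le> dp" and "ereal (max 1 (1 / dm)) < p"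
  shows "\<exists>\<delta>>0. \<exists>C>0. \<forall>(d :: nat \<Rightarrow> real) (f :: nat \<Rightarrow> complex) (N :: nat).
    (\<forall>j\<ge>1. dm \<le> d j \<and> d j \<le> dp) \<longrightarrow>
    (\<forall>j\<ge>1. cmod (f j) \<le> 1) \<longrightarrow>
    N \<ge> 1 \<longrightarrow>
    rho f N p \<le> \<delta> \<longrightarrow>
    (\<exists>E :: complex. cmod E \<le> C * (rho f N p)\<^sup>2 \<and>
      M_coeff d f N / complex_of_real (p_coeff d N) =
        exp (L1 d f N) *
        (1 + (\<Sum>j=1..N. complex_of_real (d j) * ((f j - 1) / of_nat j) *
                complex_of_real (p_coeff d (N - j) / p_coeff d N - 1))
           + E))"
proof -
  \<comment> \<open>Then \<open>1 / \<theta>\<close> is exactly the threshold assumed for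
    \<open>p\<close>, while \<open>\<theta> \<le> 1\<close> keeps the Bernoulli bounds
    available.\<close>
  define \<theta> where "\<theta> = min dm 1"
  have \<theta>: "0 < \<theta>" "\<theta> \<le> 1" and "\<theta> \<le> dm" using assms(1) by (auto simp: \<theta>_def)
  have dp: "0 < dp" using assms by linarith
  have "1 / \<theta> = max 1 (1 / dm)" using assms(1) by (auto simp: \<theta>_def min_def max_def field_simps)
  hence p: "ereal (1 / \<theta>) < p" using assms(3) by simp
  obtain \<epsilon> C where \<epsilon>: "0 < \<epsilon>" "\<epsilon> < \<theta>" and C: "0 < C"
    and conv: "\<And>d f N k. \<lbrakk>\<And>j. 1 \<le> j \<Longrightarrow> 0 \<le> d j \<and> d j \<le> dp; 1 \<le> N; 1 \<le> k\<rbrakk> \<Longrightarrow>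
      (\<Sum>j=1..k. cmod (excess d f N j) * real (k - j + 1) powr (- (1 - \<theta> + \<epsilon>)))
        \<le> C * rho f N p * real k powr (1 - (1 - \<theta> + \<epsilon>))"
    using excess_convolution_bound[OF \<theta> p dp] by blast
  obtain \<delta> K :: real where \<delta>: "0 < \<delta>" and K: "0 < K" and remainder:
    "\<And>(c :: nat \<Rightarrow> complex) N \<eta> n. 1 \<le> N \<Longrightarrow> 0 \<le> \<eta> \<Longrightarrow> \<eta> \<le> \<delta> \<Longrightarrow> (\<And>j. N < j \<Longrightarrow> c j = 0) \<Longrightarrow>
      (\<And>k. 1 \<le> k \<Longrightarrow> (\<Sum>j=1..k. cmod (c j) * real (k - j + 1) powr (- (1 - \<theta> + \<epsilon>)))
        \<le> \<eta> * real k powr (1 - (1 - \<theta> + \<epsilon>))) \<Longrightarrow>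
      cmod (fps_nth (binom_series \<theta> * (centered_exp c N - 1 - centered_log c N)) n)
        \<le> K * \<eta>\<^sup>2 * (real N powr \<epsilon> * real (n + 1) powr (\<theta> - 1 - \<epsilon>))"
    using binom_remainder_bound[OF \<theta> \<epsilon>(1) less_imp_le[OF \<epsilon>(2)]] by blast
  define G where "G = (4 * dp / (\<theta> - \<epsilon>) + 2) * (2 / \<theta>)"
  have G: "0 < G" using dp \<theta> \<epsilon> by (simp add: G_def add_nonneg_pos)
  show ?thesis
  \<comment> \<open>The remainder bound is used with \<open>\<eta> = C * rho f N p\<close>, which
    must not exceed \<delta>; \<open>G\<close> is the cost of the comparison with
    \<open>p_coeff d N\<close>.\<close>
  proof (rule exI[of _ "\<delta> / C"], rule conjI, use \<delta> C in simp,
      rule exI[of _ "K * C\<^sup>2 * G"], rule conjI, use K C G in simp, intro allI impI)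
    fix d :: "nat \<Rightarrow> real" and f :: "nat \<Rightarrow> complex" and N :: nat
    assume d: "\<forall>j\<ge>1. dm \<le> d j \<and> d j \<le> dp" and N: "1 \<le> N" and rho: "rho f N p \<le> \<delta> / C"
    define Q where "Q = centered_exp (excess d f N) N - 1 - centered_log (excess d f N) N"
    \<comment> \<open>Nonnegative weights of the cofactor left after splitting off the binomial
      series.\<close>
    define e where "e j = d j - \<theta>" for j
    have d': "0 \<le> d j \<and> d j \<le> dp" if "1 \<le> j" for j
      using d that assms(1) by (meson less_imp_le order_trans)
    have e: "0 \<le> e j \<and> e j \<le> dp" if "1 \<le> j" for j
      using d that \<open>\<theta> \<le> dm\<close> \<theta> unfolding e_def by fastforce
    \<comment> \<open>Read off from the convolution bound at \<open>k = 1\<close>, which avoids a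
      case distinction on \<open>p\<close>.\<close>
    have "0 \<le> C * rho f N p"
      using order_trans[OF _ conv[OF d' N, where k = 1 and f = f]] by simp
    hence rho0: "0 \<le> rho f N p" using C by (simp add: zero_le_mult_iff)
    have Q: "cmod (fps_nth (binom_series \<theta> * Q) n)
        \<le> K * (C * rho f N p)\<^sup>2 * (real N powr \<epsilon> * real (n + 1) powr (\<theta> - 1 - \<epsilon>))" for n
      unfolding Q_def
    proof (rule remainder[OF N])
      show "C * rho f N p \<le> \<delta>" using rho C by (simp add: field_simps)
    qed (use conv[OF d' N] C rho0 in \<open>auto simp: excess_def\<close>)
    have split: "exp_series d = exp_series e * binom_series \<theta>"
      unfolding exp_series_add[symmetric] by (simp add: e_def)
    have B: "0 \<le> fps_nth (exp_series e) k" for k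
      using e by (intro exp_series_nonneg) auto
    have p_pos: "0 < p_coeff d N"
    proof -
      \<comment> \<open>All terms of the convolution are nonnegative, and the one at index 0 of the
        cofactor is a positive binomial coefficient.\<close>
      have "0 < fps_nth (exp_series e) 0 * fps_nth (binom_series \<theta> :: real fps) N"
        using less_le_trans[OF _ binom_series_bounds(1)[OF \<theta>, of N]] \<theta> by simp
      also have "\<dots> \<le> (\<Sum>i=0..N. fps_nth (exp_series e) i * fps_nth (binom_series \<theta> :: real fps) (N - i))"
        using member_le_sum[of 0 "{0..N}" "\<lambda>i. fps_nth (exp_series e) i * fps_nth (binom_series \<theta> :: real fps) (N - i)"]
          B exp_series_nonneg[of "\<lambda>_. \<theta>"] \<theta> by simp
      finally show ?thesis by (simp only: p_coeff_def split fps_mult_nth)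
    qed
    \<comment> \<open>Attaching the binomial factor to \<open>Q\<close> leaves a convolution of the
      bounded coefficients with nonnegative ones, to which the comparison applies.\<close>
    have "exp_series (\<lambda>j. complex_of_real (d j)) = exp_series (\<lambda>j. complex_of_real (e j)) * binom_series \<theta>"
      unfolding exp_series_add[symmetric] by (simp add: e_def)
    hence "fps_nth (exp_series (\<lambda>j. complex_of_real (d j)) * Q) N
        = fps_nth ((binom_series \<theta> * Q) * exp_series (\<lambda>j. complex_of_real (e j))) N"
      by (simp add: mult_ac)
    also have "\<dots> = (\<Sum>k\<le>N. fps_nth (binom_series \<theta> * Q) k * of_real (fps_nth (exp_series e) (N - k)))"
      by (subst fps_mult_nth) (simp add: atLeast0AtMost exp_series_of_real)
    also have "cmod \<dots> \<le> (\<Sum>k\<le>N. K * (C * rho f N p)\<^sup>2 *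
        (fps_nth (exp_series e) (N - k) * (real N powr \<epsilon> * real (k + 1) powr (\<theta> - 1 - \<epsilon>))))"
    proof (rule sum_norm_le)
      fix k
      show "cmod (fps_nth (binom_series \<theta> * Q) k * of_real (fps_nth (exp_series e) (N - k)))
        \<le> K * (C * rho f N p)\<^sup>2 *
          (fps_nth (exp_series e) (N - k) * (real N powr \<epsilon> * real (k + 1) powr (\<theta> - 1 - \<epsilon>)))"
        using mult_right_mono[OF Q[of k] B[of "N - k"]] B[of "N - k"]
        by (simp only: norm_mult norm_of_real abs_of_nonneg mult_ac)
    qed
    also have "\<dots> \<le> K * (C * rho f N p)\<^sup>2 * (G * p_coeff d N)"
      unfolding sum_distrib_left[symmetric] G_def p_coeff_def split
      using K by (intro mult_left_mono binom_series_comparison[OF \<theta> \<epsilon> e N]) auto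
    finally have "cmod (fps_nth (exp_series (\<lambda>j. complex_of_real (d j)) * Q) N / complex_of_real (p_coeff d N))
        \<le> K * C\<^sup>2 * G * (rho f N p)\<^sup>2"
      using p_pos by (simp add: norm_divide divide_le_eq power_mult_distrib mult_ac)
    thus "\<exists>E :: complex. cmod E \<le> K * C\<^sup>2 * G * (rho f N p)\<^sup>2 \<and>
      M_coeff d f N / complex_of_real (p_coeff d N) =
        exp (L1 d f N) *
        (1 + (\<Sum>j=1..N. complex_of_real (d j) * ((f j - 1) / of_nat j) *
                complex_of_real (p_coeff d (N - j) / p_coeff d N - 1))
           + E)"
      using M_coeff_expansion[of d N f] p_pos unfolding Q_def by (intro exI conjI) auto
  qed
qed

end
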